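(* Let $X$ be a topological space. Suppose $\alpha_i\in H^{d_i}(X;\mathbb{Z}_2)$, $i=1,\ldots,n$, are cohomology classes with coefficients in $\mathbb{Z}_2$ such that \[ \alpha_1 \smile \alpha_2 \smile \cdots \smile \alpha_n \neq 0. \] Then any simplicial cell complex homeomorphic to $X$ has at least $2^n$ simplices of dimension $d_1+d_2+\cdots+d_n$.
   Context: A simplicial cell complex (also called a regular simplicial set) is a CW-complex glued out of simplices in which every gluing/attaching map is a simplicial embedding: each simplex is attached so that its characteristic map is injective and restricts on each face to a simplicial isomorphism onto a simplex of the complex. This generalizes simplicial complexes, but two simplices may intersect in more than one common face.
   Formalization: All degrees d_i are assumed to be at least 1; without this the claim fails, e.g. for X a point, n = 1 and α_1 = 1 in H^0(X; Z_2), where the one-vertex complex has only one 0-simplex. *)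

theory Defs
  imports "HOL-Homology.Homology" "HOL-Library.Z2"
begin

section \<open>Affine maps between standard simplices\<close>

text \<open>The affine map on the standard \<open>p\<close>-simplex that sends the \<open>i\<close>-th vertex to the \<open>v i\<close>-th
  vertex, and the composition of a map \<open>f\<close>, defined on a standard simplex, with it.\<close>

definition affine_vertex_map :: "nat \<Rightarrow> (nat \<Rightarrow> nat) \<Rightarrow> (nat \<Rightarrow> real) \<Rightarrow> nat \<Rightarrow> real" where
  "affine_vertex_map p v = oriented_simplex p (\<lambda>i j. if j = v i then 1 else 0)"

definition pull_vertices ::
    "nat \<Rightarrow> (nat \<Rightarrow> nat) \<Rightarrow> ((nat \<Rightarrow> real) \<Rightarrow> 'a) \<Rightarrow> (nat \<Rightarrow> real) \<Rightarrow> 'a" where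
  "pull_vertices p v f = simplex_map p f (affine_vertex_map p v)"


section \<open>Singular cohomology with coefficients in the field of two elements\<close>

text \<open>A cochain is determined by its values on the singular simplices, which freely generate the
  chain group; it is normalised to be \<open>0\<close> on all functions that are not singular simplices.
  The signs in the coboundary disappear modulo 2.\<close>

type_synonym 'a cochain = "((nat \<Rightarrow> real) \<Rightarrow> 'a) \<Rightarrow> bit"

definition singular_cochain :: "nat \<Rightarrow> 'a topology \<Rightarrow> 'a cochain \<Rightarrow> bool" where
  "singular_cochain p X c \<longleftrightarrow> (\<forall>f. c f \<noteq> 0 \<longrightarrow> singular_simplex p X f)"

definition cochain_coboundary :: "nat \<Rightarrow> 'a topology \<Rightarrow> 'a cochain \<Rightarrow> 'a cochain" where
  "cochain_coboundary p X c =
    (\<lambda>f. if singular_simplex (Suc p) X f then \<Sum>k\<le>Suc p. c (singular_face (Suc p) k f) else 0)"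

definition singular_cocycle_set :: "nat \<Rightarrow> 'a topology \<Rightarrow> 'a cochain set" where
  "singular_cocycle_set p X =
    {c. singular_cochain p X c \<and> cochain_coboundary p X c = (\<lambda>f. 0)}"

fun singular_coboundary_set :: "nat \<Rightarrow> 'a topology \<Rightarrow> 'a cochain set" where
  "singular_coboundary_set 0 X = {\<lambda>f. 0}"
| "singular_coboundary_set (Suc p) X = cochain_coboundary p X ` {c. singular_cochain p X c}"

definition cocycle_group :: "nat \<Rightarrow> 'a topology \<Rightarrow> 'a cochain monoid" where
  "cocycle_group p X =
    \<lparr>carrier = singular_cocycle_set p X, mult = (\<lambda>a b f. a f + b f), one = (\<lambda>f. 0)\<rparr>"

definition cohomology_group :: "nat \<Rightarrow> 'a topology \<Rightarrow> 'a cochain set monoid" where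
  "cohomology_group p X = cocycle_group p X Mod singular_coboundary_set p X"


section \<open>The cup product\<close>

definition cochain_cup ::
    "nat \<Rightarrow> nat \<Rightarrow> 'a topology \<Rightarrow> 'a cochain \<Rightarrow> 'a cochain \<Rightarrow> 'a cochain" where
  "cochain_cup p q X a b =
    (\<lambda>f. if singular_simplex (p + q) X f
         then a (pull_vertices p (\<lambda>i. i) f) * b (pull_vertices q (\<lambda>i. p + i) f) else 0)"

text \<open>The class of \<open>a \<smile> b\<close> does not depend on the representatives \<open>a\<close> and \<open>b\<close>, so that
  the following union is over one and the same coset (see \<open>cup_coset\<close> below).\<close>

definition cup ::
    "nat \<Rightarrow> nat \<Rightarrow> 'a topology \<Rightarrow> 'a cochain set \<Rightarrow> 'a cochain set \<Rightarrow> 'a cochain set" where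
  "cup p q X A B =
    (\<Union>a\<in>A. \<Union>b\<in>B. singular_coboundary_set (p + q) X
       #>\<^bsub>cocycle_group (p + q) X\<^esub> cochain_cup p q X a b)"

definition cohomology_unit :: "'a topology \<Rightarrow> 'a cochain set" where
  "cohomology_unit X =
    singular_coboundary_set 0 X #>\<^bsub>cocycle_group 0 X\<^esub> (\<lambda>f. if singular_simplex 0 X f then 1 else 0)"

text \<open>The product of \<open>\<alpha> 1, \<dots>, \<alpha> n\<close>, bracketed to the left, where \<open>\<alpha> i\<close> has degree \<open>d i\<close>.
  The empty product is the unit.\<close>

fun cup_prod :: "'a topology \<Rightarrow> (nat \<Rightarrow> nat) \<Rightarrow> (nat \<Rightarrow> 'a cochain set) \<Rightarrow> nat \<Rightarrow> 'a cochain set" where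
  "cup_prod X d \<alpha> 0 = cohomology_unit X"
| "cup_prod X d \<alpha> (Suc 0) = \<alpha> 1"
| "cup_prod X d \<alpha> (Suc (Suc n)) =
    cup (\<Sum>i=1..Suc n. d i) (d (Suc (Suc n))) X (cup_prod X d \<alpha> (Suc n)) (\<alpha> (Suc (Suc n)))"


subsection \<open>The cup product is well defined\<close>

context
  notes add_bit_eq_xor [simp del] mult_bit_eq_and [simp del]
begin

lemma affine_vertex_map_apply:
  "x \<in> standard_simplex p \<Longrightarrow> affine_vertex_map p v x = (\<lambda>i. \<Sum>j | j \<le> p \<and> v j = i. x j)"
proof
  fix i
  assume x: "x \<in> standard_simplex p"
  have "(\<Sum>j | j \<le> p \<and> v j = i. x j) = (\<Sum>j\<le>p. if v j = i then x j else 0)"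
    using sum.inter_filter[of "{..p}" x "\<lambda>j. v j = i"] by simp
  also have "\<dots> = (\<Sum>j\<le>p. (if i = v j then 1 else 0) * x j)"
    by (rule sum.cong) auto
  finally show "affine_vertex_map p v x i = (\<Sum>j | j \<le> p \<and> v j = i. x j)"
    using x by (simp add: affine_vertex_map_def oriented_simplex_def)
qed

lemma affine_vertex_map_in:
  assumes x: "x \<in> standard_simplex p" and v: "\<And>j. j \<le> p \<Longrightarrow> v j \<le> q"
  shows "affine_vertex_map p v x \<in> standard_simplex q"
proof -
  have x0: "\<And>i. 0 \<le> x i" and x1: "sum x {..p} = 1"
    using x by (auto simp: standard_simplex_def)
  have "(\<Sum>j | j \<le> p \<and> v j = i. x j) \<le> sum x {..p}" for i
    by (rule sum_mono2) (auto simp: x0)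
  moreover have "(\<Sum>i\<le>q. \<Sum>j | j \<le> p \<and> v j = i. x j) = sum x {..p}"
    using sum.group[of "{..p}" "{..q}" v x] v by auto
  moreover have "(\<Sum>j | j \<le> p \<and> v j = i. x j) = 0" if "q < i" for i
    using v that by (intro sum.neutral) fastforce
  ultimately show ?thesis
    using x0 x1 by (auto simp: standard_simplex_def affine_vertex_map_apply[OF x] sum_nonneg)
qed

lemma affine_vertex_map_compose:
  assumes x: "x \<in> standard_simplex p" and v: "\<And>j. j \<le> p \<Longrightarrow> v j \<le> q"
  shows "affine_vertex_map q w (affine_vertex_map p v x) = affine_vertex_map p (\<lambda>j. w (v j)) x"
proof
  fix i
  have "(\<Sum>j | j \<le> q \<and> w j = i. \<Sum>l | l \<le> p \<and> v l = j. x l) = (\<Sum>l | l \<le> p \<and> w (v l) = i. x l)"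
  proof -
    have "(\<Sum>j | j \<le> q \<and> w j = i. \<Sum>l | l \<le> p \<and> v l = j. x l)
        = (\<Sum>j | j \<le> q \<and> w j = i. \<Sum>l | l \<in> {l. l \<le> p \<and> w (v l) = i} \<and> v l = j. x l)"
      by (intro sum.cong refl) auto
    also have "\<dots> = (\<Sum>l | l \<le> p \<and> w (v l) = i. x l)"
      by (rule sum.group) (use v in auto)
    finally show ?thesis .
  qed
  moreover have "affine_vertex_map p v x \<in> standard_simplex q"
    using x v by (rule affine_vertex_map_in)
  ultimately show "affine_vertex_map q w (affine_vertex_map p v x) i = affine_vertex_map p (\<lambda>j. w (v j)) x i"
    by (simp only: affine_vertex_map_apply[OF x] affine_vertex_map_apply[of _ q])
qed

lemma affine_vertex_map_cong:
  assumes "\<And>j. j \<le> p \<Longrightarrow> v j = w j"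
  shows "affine_vertex_map p v = affine_vertex_map p w"
  using assms by (auto simp: affine_vertex_map_def oriented_simplex_eq)

lemma pull_vertices_cong:
  "(\<And>j. j \<le> p \<Longrightarrow> v j = w j) \<Longrightarrow> pull_vertices p v f = pull_vertices p w f"
  unfolding pull_vertices_def by (simp cong: affine_vertex_map_cong)

lemma pull_vertices_compose:
  assumes "\<And>j. j \<le> p \<Longrightarrow> v j \<le> q"
  shows "pull_vertices p v (pull_vertices q w f) = pull_vertices p (\<lambda>j. w (v j)) f"
  using assms
  by (auto simp: pull_vertices_def simplex_map_def fun_eq_iff restrict_def
      affine_vertex_map_in affine_vertex_map_compose)

lemma singular_simplex_pull_vertices:
  assumes f: "singular_simplex q X f" and v: "\<And>j. j \<le> p \<Longrightarrow> v j \<le> q"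
  shows "singular_simplex p X (pull_vertices p v f)"
proof -
  have "simplicial_simplex p (standard_simplex q) (affine_vertex_map p v)"
    unfolding simplicial_simplex using affine_vertex_map_in[OF _ v]
    by (auto simp: affine_vertex_map_def)
  then show ?thesis
    unfolding pull_vertices_def using f
    by (intro singular_simplex_simplex_map[OF simplicial_imp_singular_simplex])
       (auto simp: singular_simplex_def)
qed

abbreviation skip :: "nat \<Rightarrow> nat \<Rightarrow> nat" where
  "skip k \<equiv> (\<lambda>i. if i < k then i else Suc i)"

lemma singular_face_pull_vertices:
  assumes "k \<le> Suc p"
  shows "singular_face (Suc p) k f = pull_vertices p (skip k) f"
proof -
  have "simplical_face k x = affine_vertex_map p (skip k) x" if x: "x \<in> standard_simplex p" for x
  proof
    fix i
    have x0: "\<And>j. p < j \<Longrightarrow> x j = 0" using x by (auto simp: standard_simplex_def)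
    have "{j. j \<le> p \<and> skip k j = i} =
        (if i < k then if i \<le> p then {i} else {}
         else if i = k then {} else if i - 1 \<le> p then {i - 1} else {})"
      by auto
    then show "simplical_face k x i = affine_vertex_map p (skip k) x i"
      using x0 by (auto simp: simplical_face_def affine_vertex_map_apply[OF x])
  qed
  then show ?thesis
    by (intro ext) (auto simp: singular_face_def pull_vertices_def simplex_map_def restrict_def)
qed

lemma pull_vertices_id:
  assumes "singular_simplex p X f"
  shows "pull_vertices p (\<lambda>i. i) f = f"
proof -
  have "affine_vertex_map p (\<lambda>i. i) x = x" if x: "x \<in> standard_simplex p" for x
  proof
    fix i
    have "x i = 0" if "\<not> i \<le> p" using that x by (auto simp: standard_simplex_def)
    moreover have "{j. j \<le> p \<and> j = i} = (if i \<le> p then {i} else {})" by auto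
    ultimately show "affine_vertex_map p (\<lambda>i. i) x i = x i"
      by (auto simp: affine_vertex_map_apply[OF x])
  qed
  then show ?thesis
    using assms by (intro ext) (auto simp: pull_vertices_def simplex_map_def restrict_def
        singular_simplex_def extensional_def)
qed

lemma cochain_coboundary_apply:
  assumes "singular_simplex (Suc p) X f"
  shows "cochain_coboundary p X c f = (\<Sum>k\<le>Suc p. c (pull_vertices p (skip k) f))"
  using assms by (simp add: cochain_coboundary_def singular_face_pull_vertices del: sum.atMost_Suc)

lemma bit_add_self: "a + a = (0::bit)" "a + (a + b) = (b::bit)"
  by (cases a; cases b; simp)+

lemma cochain_coboundary_twice:
  "cochain_coboundary (Suc p) X (cochain_coboundary p X c) = (\<lambda>f. 0)"
proof
  fix f
  show "cochain_coboundary (Suc p) X (cochain_coboundary p X c) f = 0"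
  proof (cases "singular_simplex (Suc (Suc p)) X f")
    case True
    define g where "g k l = c (pull_vertices p (\<lambda>i. skip k (skip l i)) f)" for k l
    have "cochain_coboundary (Suc p) X (cochain_coboundary p X c) f
        = (\<Sum>k\<le>Suc (Suc p). cochain_coboundary p X c (pull_vertices (Suc p) (skip k) f))"
      by (rule cochain_coboundary_apply[OF True])
    also have "\<dots> = (\<Sum>k\<le>Suc (Suc p). \<Sum>l\<le>Suc p. g k l)"
    proof (rule sum.cong[OF refl])
      fix k assume "k \<in> {..Suc (Suc p)}"
      have "singular_simplex (Suc p) X (pull_vertices (Suc p) (skip k) f)"
        by (rule singular_simplex_pull_vertices[OF True]) auto
      then have "cochain_coboundary p X c (pull_vertices (Suc p) (skip k) f)
          = (\<Sum>l\<le>Suc p. c (pull_vertices p (skip l) (pull_vertices (Suc p) (skip k) f)))"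
        by (rule cochain_coboundary_apply)
      also have "\<dots> = (\<Sum>l\<le>Suc p. g k l)"
        unfolding g_def
        by (rule sum.cong[OF refl], subst pull_vertices_compose) auto
      finally show "cochain_coboundary p X c (pull_vertices (Suc p) (skip k) f) = (\<Sum>l\<le>Suc p. g k l)" .
    qed
    also have "\<dots> = sum (\<lambda>(k, l). g k l) ({..Suc (Suc p)} \<times> {..Suc p})"
      by (rule sum.cartesian_product)
    also have "{..Suc (Suc p)} \<times> {..Suc p} =
        {(k, l). k \<le> l \<and> l \<le> Suc p} \<union> {(k, l). l < k \<and> k \<le> Suc (Suc p)}" (is "_ = ?A \<union> ?B")
      by auto
    also have "sum (\<lambda>(k, l). g k l) (?A \<union> ?B) = sum (\<lambda>(k, l). g k l) ?A + sum (\<lambda>(k, l). g k l) ?B"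
    proof (rule sum.union_disjoint)
      show "finite ?A" by (rule finite_subset[of _ "{..Suc p} \<times> {..Suc p}"]) auto
      show "finite ?B" by (rule finite_subset[of _ "{..Suc (Suc p)} \<times> {..Suc p}"]) auto
    qed auto
    also have "sum (\<lambda>(k, l). g k l) ?B = sum (\<lambda>(k, l). g k l) ?A"
    proof (rule sum.reindex_bij_witness[where i = "\<lambda>(k, l). (Suc l, k)" and j = "\<lambda>(k, l). (l, k - 1)"])
      fix z assume "z \<in> ?B"
      then obtain k l where z: "z = (Suc k, l)" "l \<le> k" "k \<le> Suc p"
        by (cases z; cases "fst z") auto
      have "pull_vertices p (\<lambda>i. skip l (skip k i)) f = pull_vertices p (\<lambda>i. skip (Suc k) (skip l i)) f"
        using z by (intro pull_vertices_cong) auto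
      then show "(case case z of (k, l) \<Rightarrow> (l, k - 1) of (k, l) \<Rightarrow> g k l) = (case z of (k, l) \<Rightarrow> g k l)"
        using z by (simp add: g_def)
    qed auto
    finally show ?thesis by (simp only: bit_add_self)
  qed (simp add: cochain_coboundary_def)
qed

lemma cochain_coboundary_add:
  "cochain_coboundary p X (\<lambda>f. a f + b f) = (\<lambda>f. cochain_coboundary p X a f + cochain_coboundary p X b f)"
  by (auto simp: cochain_coboundary_def fun_eq_iff sum.distrib simp del: sum.atMost_Suc)

lemma cochain_coboundary_zero [simp]: "cochain_coboundary p X (\<lambda>f. 0) = (\<lambda>f. 0)"
  by (auto simp: cochain_coboundary_def)

lemma singular_cochain_zero [simp]: "singular_cochain p X (\<lambda>f. 0)"
  by (simp add: singular_cochain_def)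

lemma singular_cochain_add:
  "\<lbrakk>singular_cochain p X a; singular_cochain p X b\<rbrakk> \<Longrightarrow> singular_cochain p X (\<lambda>f. a f + b f)"
  unfolding singular_cochain_def
proof (intro allI impI)
  fix f assume *: "\<forall>f. a f \<noteq> 0 \<longrightarrow> singular_simplex p X f" "\<forall>f. b f \<noteq> 0 \<longrightarrow> singular_simplex p X f"
    and "a f + b f \<noteq> 0"
  then have "a f \<noteq> 0 \<or> b f \<noteq> 0" by (cases "a f"; cases "b f") simp_all
  then show "singular_simplex p X f" using * by blast
qed

lemma singular_cochain_coboundary: "singular_cochain (Suc p) X (cochain_coboundary p X c)"
  by (auto simp: singular_cochain_def cochain_coboundary_def)

lemma singular_cochain_cup: "singular_cochain (p + q) X (cochain_cup p q X a b)"
  by (auto simp: singular_cochain_def cochain_cup_def)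

lemma comm_group_cocycle_group: "comm_group (cocycle_group p X)"
proof (rule comm_groupI)
  show "\<exists>y\<in>carrier (cocycle_group p X). y \<otimes>\<^bsub>cocycle_group p X\<^esub> x = \<one>\<^bsub>cocycle_group p X\<^esub>"
    if "x \<in> carrier (cocycle_group p X)" for x
    using that by (intro bexI[of _ x]) (auto simp: cocycle_group_def bit_add_self)
qed (auto simp: cocycle_group_def singular_cocycle_set_def cochain_coboundary_add
      singular_cochain_add add_ac)

lemma coboundary_in_cocycle: "b \<in> singular_coboundary_set p X \<Longrightarrow> b \<in> singular_cocycle_set p X"
  by (cases p) (auto simp: singular_cocycle_set_def cochain_coboundary_twice singular_cochain_coboundary)

lemma coboundary_add:
  "\<lbrakk>a \<in> singular_coboundary_set p X; b \<in> singular_coboundary_set p X\<rbrakk>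
    \<Longrightarrow> (\<lambda>f. a f + b f) \<in> singular_coboundary_set p X"
  by (cases p) (auto simp flip: cochain_coboundary_add intro!: imageI singular_cochain_add)

lemma subgroup_coboundary: "subgroup (singular_coboundary_set p X) (cocycle_group p X)"
proof -
  interpret comm_group "cocycle_group p X" by (rule comm_group_cocycle_group)
  have zero: "(\<lambda>f. 0) \<in> singular_coboundary_set p X"
    by (cases p) (auto intro!: image_eqI[where x = "\<lambda>f. 0"])
  have inv: "inv\<^bsub>cocycle_group p X\<^esub> a = a" if "a \<in> carrier (cocycle_group p X)" for a
    using that by (intro inv_equality) (auto simp: cocycle_group_def bit_add_self)
  show ?thesis
  proof (rule subgroupI)
    fix a assume "a \<in> singular_coboundary_set p X"
    then show "inv\<^bsub>cocycle_group p X\<^esub> a \<in> singular_coboundary_set p X"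
      using inv[of a] coboundary_in_cocycle[of a p X] by (simp add: cocycle_group_def)
  qed (use zero in \<open>auto simp: cocycle_group_def coboundary_in_cocycle coboundary_add\<close>)
qed

lemma comm_group_cohomology_group: "comm_group (cohomology_group p X)"
  unfolding cohomology_group_def
  by (intro comm_group.abelian_FactGroup comm_group_cocycle_group subgroup_coboundary)

lemma cochain_coboundary_cup:
  "cochain_coboundary (p + q) X (cochain_cup p q X a b) =
    (\<lambda>f. cochain_cup (Suc p) q X (cochain_coboundary p X a) b f
       + cochain_cup p (Suc q) X a (cochain_coboundary q X b) f)"
proof
  fix f
  show "cochain_coboundary (p + q) X (cochain_cup p q X a b) f =
      cochain_cup (Suc p) q X (cochain_coboundary p X a) b f
       + cochain_cup p (Suc q) X a (cochain_coboundary q X b) f" (is "?L = ?R1 + ?R2")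
  proof (cases "singular_simplex (Suc (p + q)) X f")
    case True
    define u where "u k = a (pull_vertices p (skip k) f)" for k
    define w where "w k = b (pull_vertices q (\<lambda>i. p + skip k i) f)" for k
    have "?L = (\<Sum>k\<le>Suc (p + q). cochain_cup p q X a b (pull_vertices (p + q) (skip k) f))"
      by (rule cochain_coboundary_apply[OF True])
    also have "\<dots> = (\<Sum>k\<le>Suc (p + q). a (pull_vertices p (skip k) f)
        * b (pull_vertices q (\<lambda>i. skip k (p + i)) f))"
      using True by (intro sum.cong refl)
        (simp add: cochain_cup_def singular_simplex_pull_vertices pull_vertices_compose)
    also have "\<dots> = (\<Sum>k\<in>{..p} \<union> {p+1..p+q+1}. a (pull_vertices p (skip k) f)
        * b (pull_vertices q (\<lambda>i. skip k (p + i)) f))"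
      by (intro sum.cong) auto
    also have "\<dots> = (\<Sum>k\<le>p. a (pull_vertices p (skip k) f)
        * b (pull_vertices q (\<lambda>i. skip k (p + i)) f))
       + (\<Sum>k=p+1..p+q+1. a (pull_vertices p (skip k) f)
        * b (pull_vertices q (\<lambda>i. skip k (p + i)) f))"
      by (intro sum.union_disjoint) auto
    also have "(\<Sum>k\<le>p. a (pull_vertices p (skip k) f)
        * b (pull_vertices q (\<lambda>i. skip k (p + i)) f)) = (\<Sum>k\<le>p. u k * w 0)"
      unfolding u_def w_def
      by (intro sum.cong refl arg_cong2[where f = "(*)"] arg_cong[where f = b] pull_vertices_cong) auto
    also have "(\<Sum>k=p+1..p+q+1. a (pull_vertices p (skip k) f)
        * b (pull_vertices q (\<lambda>i. skip k (p + i)) f)) = (\<Sum>k=1..q+1. u (Suc p) * w k)"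
    proof (rule sum.reindex_bij_witness[where i = "\<lambda>k. p + k" and j = "\<lambda>k. k - p"])
      fix k assume "k \<in> {p+1..p+q+1}"
      then show "u (Suc p) * w (k - p) = a (pull_vertices p (skip k) f)
        * b (pull_vertices q (\<lambda>i. skip k (p + i)) f)"
        unfolding u_def w_def
        by (intro arg_cong2[where f = "(*)"] arg_cong[where f = b] arg_cong[where f = a] pull_vertices_cong) auto
    qed auto
    finally have L: "?L = (\<Sum>k\<le>p. u k * w 0) + (\<Sum>k=1..q+1. u (Suc p) * w k)" .
    have b_eq: "b (pull_vertices q (\<lambda>i. Suc p + i) f) = w 0"
      unfolding w_def by (intro arg_cong[where f = b] pull_vertices_cong) auto
    have "?R1 = (\<Sum>k\<le>Suc p. u k) * w 0"
      using True
      by (simp add: cochain_cup_def cochain_coboundary_apply singular_simplex_pull_vertices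
          pull_vertices_compose u_def b_eq del: sum.atMost_Suc)
    also have "\<dots> = (\<Sum>k\<le>p. u k * w 0) + u (Suc p) * w 0"
      by (simp add: sum_distrib_right distrib_right)
    finally have R1: "?R1 = (\<Sum>k\<le>p. u k * w 0) + u (Suc p) * w 0" .
    have "pull_vertices p (\<lambda>i. i) f = pull_vertices p (skip (Suc p)) f"
      by (rule pull_vertices_cong) auto
    then have "?R2 = u (Suc p) * (\<Sum>k\<le>Suc q. w k)"
      using True
      by (simp add: cochain_cup_def cochain_coboundary_apply singular_simplex_pull_vertices
          pull_vertices_compose u_def w_def del: sum.atMost_Suc)
    also have "{..Suc q} = insert 0 {1..q+1}" by auto
    finally have R2: "?R2 = u (Suc p) * w 0 + (\<Sum>k=1..q+1. u (Suc p) * w k)"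
      by (simp add: sum_distrib_left distrib_left)
    show ?thesis
      unfolding L R1 R2 by (simp only: add.assoc bit_add_self)
  qed (simp add: cochain_coboundary_def cochain_cup_def)
qed

lemma cochain_cup_zero [simp]:
  "cochain_cup p q X (\<lambda>f. 0) b = (\<lambda>f. 0)" "cochain_cup p q X a (\<lambda>f. 0) = (\<lambda>f. 0)"
  by (auto simp: cochain_cup_def)

lemma cochain_cup_add:
  "cochain_cup p q X (\<lambda>f. a f + a' f) b = (\<lambda>f. cochain_cup p q X a b f + cochain_cup p q X a' b f)"
  "cochain_cup p q X a (\<lambda>f. b f + b' f) = (\<lambda>f. cochain_cup p q X a b f + cochain_cup p q X a b' f)"
  by (intro ext, simp add: cochain_cup_def distrib_left distrib_right)+

lemma cochain_cup_cocycle: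
  "\<lbrakk>a \<in> singular_cocycle_set p X; b \<in> singular_cocycle_set q X\<rbrakk>
    \<Longrightarrow> cochain_cup p q X a b \<in> singular_cocycle_set (p + q) X"
  by (simp add: singular_cocycle_set_def singular_cochain_cup cochain_coboundary_cup)

lemma cochain_cup_coboundary:
  assumes "a \<in> singular_cocycle_set p X" "b \<in> singular_cocycle_set q X"
    and "a \<in> singular_coboundary_set p X \<or> b \<in> singular_coboundary_set q X"
  shows "cochain_cup p q X a b \<in> singular_coboundary_set (p + q) X"
  using assms(3)
proof
  assume a: "a \<in> singular_coboundary_set p X"
  show ?thesis
  proof (cases p)
    case 0
    then show ?thesis
      using a subgroup.one_closed[OF subgroup_coboundary[of q X]] by (simp add: cocycle_group_def)
  next
    case (Suc r)
    then obtain c where "singular_cochain r X c" "a = cochain_coboundary r X c" using a by auto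
    then have eq: "cochain_coboundary (r + q) X (cochain_cup r q X c b) = cochain_cup p q X a b"
      using assms(2) Suc by (simp add: cochain_coboundary_cup singular_cocycle_set_def)
    show ?thesis
      unfolding eq[symmetric] unfolding Suc add_Suc singular_coboundary_set.simps
      by (rule imageI) (simp add: singular_cochain_cup)
  qed
next
  assume b: "b \<in> singular_coboundary_set q X"
  show ?thesis
  proof (cases q)
    case 0
    then show ?thesis
      using b subgroup.one_closed[OF subgroup_coboundary[of p X]] by (simp add: cocycle_group_def)
  next
    case (Suc r)
    then obtain c where "singular_cochain r X c" "b = cochain_coboundary r X c" using b by auto
    then have eq: "cochain_coboundary (p + r) X (cochain_cup p r X a c) = cochain_cup p q X a b"
      using assms(1) Suc by (simp add: cochain_coboundary_cup singular_cocycle_set_def)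
    show ?thesis
      unfolding eq[symmetric] unfolding Suc add_Suc_right singular_coboundary_set.simps
      by (rule imageI) (simp add: singular_cochain_cup)
  qed
qed

lemma cup_coset:
  assumes a: "a \<in> singular_cocycle_set p X" and b: "b \<in> singular_cocycle_set q X"
  shows "cup p q X (singular_coboundary_set p X #>\<^bsub>cocycle_group p X\<^esub> a)
      (singular_coboundary_set q X #>\<^bsub>cocycle_group q X\<^esub> b)
    = singular_coboundary_set (p + q) X #>\<^bsub>cocycle_group (p + q) X\<^esub> cochain_cup p q X a b"
proof -
  let ?B = "singular_coboundary_set"
  let ?G = "cocycle_group (p + q) X"
  interpret G: comm_group ?G by (rule comm_group_cocycle_group)
  have coset: "?B r X #>\<^bsub>cocycle_group r X\<^esub> c = (\<lambda>e f. e f + c f) ` ?B r X" for r c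
    by (auto simp: r_coset_def cocycle_group_def)
  have eq: "?B (p + q) X #>\<^bsub>?G\<^esub> cochain_cup p q X a' b' = ?B (p + q) X #>\<^bsub>?G\<^esub> cochain_cup p q X a b"
    if a': "a' \<in> ?B p X #>\<^bsub>cocycle_group p X\<^esub> a" and b': "b' \<in> ?B q X #>\<^bsub>cocycle_group q X\<^esub> b" for a' b'
  proof -
    obtain u where u: "u \<in> ?B p X" "a' = (\<lambda>f. u f + a f)" using a' unfolding coset by blast
    obtain w where w: "w \<in> ?B q X" "b' = (\<lambda>f. w f + b f)" using b' unfolding coset by blast
    have uz: "u \<in> singular_cocycle_set p X" and wz: "w \<in> singular_cocycle_set q X"
      using u w coboundary_in_cocycle by blast+
    define e where "e = (\<lambda>f. (cochain_cup p q X u w f + cochain_cup p q X u b f) + cochain_cup p q X a w f)"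
    have e: "e \<in> ?B (p + q) X"
      unfolding e_def using u w uz wz a b by (intro coboundary_add cochain_cup_coboundary) auto
    have "cochain_cup p q X a' b' = e \<otimes>\<^bsub>?G\<^esub> cochain_cup p q X a b"
      by (simp add: u w e_def cochain_cup_add cocycle_group_def add_ac)
    then have "cochain_cup p q X a' b' \<in> ?B (p + q) X #>\<^bsub>?G\<^esub> cochain_cup p q X a b"
      using e by (auto simp: r_coset_def)
    moreover have "cochain_cup p q X a b \<in> carrier ?G"
      using cochain_cup_cocycle[OF a b] by (simp add: cocycle_group_def)
    ultimately show ?thesis
      by (rule G.repr_independence[OF _ _ subgroup_coboundary, symmetric])
  qed
  have self: "c \<in> ?B r X #>\<^bsub>cocycle_group r X\<^esub> c" if "c \<in> singular_cocycle_set r X" for r c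
    using that group.rcos_self[OF comm_group.axioms(2)[OF comm_group_cocycle_group] _ subgroup_coboundary]
    by (simp add: cocycle_group_def)
  have const: "(\<Union>x\<in>A. \<Union>y\<in>B. F x y) = D"
    if "\<And>x y. x \<in> A \<Longrightarrow> y \<in> B \<Longrightarrow> F x y = D" "a \<in> A" "b \<in> B"
    for A B :: "'a cochain set" and F and D :: "'a cochain set"
    using that by blast
  show ?thesis
    unfolding cup_def by (rule const[OF eq self[OF a] self[OF b]])
qed

end


section \<open>Simplicial cell complexes\<close>

definition open_standard_simplex :: "nat \<Rightarrow> (nat \<Rightarrow> real) set" where
  "open_standard_simplex p = {x \<in> standard_simplex p. \<forall>i\<le>p. 0 < x i}"

text \<open>A CW structure on the space \<open>Y\<close> with index set \<open>S\<close> of simplices, where \<open>\<Phi> s\<close> is the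
  characteristic map of the simplex \<open>s\<close> of dimension \<open>sdim s\<close>. Faces of \<open>s\<close> are given by nonempty
  sets \<open>J\<close> of vertices. By \<open>simplicial_face\<close>, the boundary of a cell is a union of
  finitely many cells of smaller dimension, so that closure finiteness need not be required.\<close>

locale simplicial_cell_complex =
  fixes Y :: "'b topology"
    and S :: "'c set"
    and sdim :: "'c \<Rightarrow> nat"
    and \<Phi> :: "'c \<Rightarrow> (nat \<Rightarrow> real) \<Rightarrow> 'b"
  assumes Hausdorff: "Hausdorff_space Y"
    and characteristic_map: "s \<in> S \<Longrightarrow> singular_simplex (sdim s) Y (\<Phi> s)"
    and characteristic_inj: "s \<in> S \<Longrightarrow> inj_on (\<Phi> s) (standard_simplex (sdim s))"
    and open_cells: "y \<in> topspace Y \<Longrightarrow> \<exists>!s. s \<in> S \<and> y \<in> \<Phi> s ` open_standard_simplex (sdim s)"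
    and simplicial_face: "\<lbrakk>s \<in> S; J \<subseteq> {..sdim s}; J \<noteq> {}\<rbrakk> \<Longrightarrow>
      \<exists>t\<in>S. \<exists>v. bij_betw v {..sdim t} J \<and> pull_vertices (sdim t) v (\<Phi> s) = \<Phi> t"
    and weak_topology: "\<lbrakk>C \<subseteq> topspace Y;
      \<And>s. s \<in> S \<Longrightarrow> closedin Y (C \<inter> \<Phi> s ` standard_simplex (sdim s))\<rbrakk> \<Longrightarrow> closedin Y C"

end

theory Submission
  imports Defs "HOL-Library.Multiset" "HOL-Analysis.Abstract_Topological_Spaces"
begin

text \<open>Fix a total order of the vertices, so that every simplex of the complex becomes a singular simplex.
  If the \<open>i\<close>-th class is represented by \<open>a i + \<delta> c\<close> with \<open>c\<close> a random cochain, then its value on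
  a fixed ordered \<open>d i\<close>-simplex is a fair coin, because the facets of this simplex are distinct. Hence the
  product of the representatives is nonzero on an ordered simplex of top degree with probability \<open>2^(-n)\<close>,
  and with fewer than \<open>2^n\<close> such simplices some choice makes it vanish on all of them; this choice is made
  greedily, one factor at a time.

  It remains to see that a singular cocycle which vanishes on the ordered simplices is a coboundary.
  A coning homotopy on words in the vertices makes the cocycle vanish on all affine simplices as well.
  A cycle modulo 2 may be subdivided until its simplices are so small that the straight line homotopy
  to their simplicial approximation is defined; the vertices of the approximation depend only
  on points of the space (a vertex with maximal barycentric coordinate is chosen), so that the homotopies fit
  together. So the cocycle vanishes on all cycles modulo 2, and linear algebra over the field with two elements
  finishes the proof.\<close>

text \<open>Two cells may have all their vertices in common, so a cell is not determined by its
  vertices. Points and affine simplices are therefore described by a cell together with weights or a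
  word, and the recurrent question is whether two cells share a given face. A barycentre decides it,
  since it lies in exactly one open cell. The labels of a small simplex come in any order and with
  repetitions, so vanishing on the ordered simplices does not suffice for the prism argument; this
  is why a sorting homotopy is interposed. The straight line homotopy exists only on small simplices
  and cannot exhibit the cocycle as a coboundary on all singular simplices. Hence the detour through
  cycles, where subdivision is allowed; the primitive then comes from linear algebra alone. The
  complex may be infinite; what replaces finiteness is that a compact set meets only finitely many
  open cells.\<close>

declare add_bit_eq_xor [simp del] mult_bit_eq_and [simp del]

section \<open>Linear algebra modulo 2\<close>

lemma bit_add_eq_0_iff: "a + b = 0 \<longleftrightarrow> a = (b::bit)"
  by (cases a; cases b; simp)

text \<open>A finitely supported function with values in \<open>bit\<close> amounts to the finite
  set of its keys. Addition is symmetric difference, and the overlap, counted twice,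
  cancels.\<close>

lemma sum_keys_add:
  fixes \<phi> :: "'x \<Rightarrow> 'v::ab_group_add" and m n :: "'x \<Rightarrow>\<^sub>0 bit"
  assumes "\<And>v::'v. v + v = 0"
  shows "sum \<phi> (Poly_Mapping.keys (m + n)) = sum \<phi> (Poly_Mapping.keys m) + sum \<phi> (Poly_Mapping.keys n)"
proof -
  let ?M = "Poly_Mapping.keys m" and ?N = "Poly_Mapping.keys n"
  have lk: "a + b \<noteq> 0 \<longleftrightarrow> (a \<noteq> 0) \<noteq> (b \<noteq> 0)" for a b :: bit
    by (cases a; cases b; simp)
  have "Poly_Mapping.keys (m + n) = (?M - ?N) \<union> (?N - ?M)"
    by (auto simp: in_keys_iff lookup_add lk simp del: bit_not_zero_iff bit_not_one_iff)
  moreover have "sum \<phi> ((?M - ?N) \<union> (?N - ?M)) = sum \<phi> (?M - ?N) + sum \<phi> (?N - ?M)"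
    by (rule sum.union_disjoint) auto
  moreover have "sum \<phi> ?M = sum \<phi> (?M - ?N) + sum \<phi> (?M \<inter> ?N)"
    by (subst sum.union_disjoint[symmetric]) (auto intro!: sum.cong)
  moreover have "sum \<phi> ?N = sum \<phi> (?N - ?M) + sum \<phi> (?M \<inter> ?N)"
    by (subst sum.union_disjoint[symmetric]) (auto intro!: sum.cong)
  ultimately have "sum \<phi> ?M + sum \<phi> ?N
      = sum \<phi> (Poly_Mapping.keys (m + n)) + (sum \<phi> (?M \<inter> ?N) + sum \<phi> (?M \<inter> ?N))"
    by (simp add: algebra_simps)
  then show ?thesis
    by (simp add: assms)
qed

lemma sum_keys_sum:
  fixes u :: "'x \<Rightarrow> bit" and v :: "'a \<Rightarrow> 'x \<Rightarrow>\<^sub>0 bit"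
  shows "sum u (Poly_Mapping.keys (sum v A)) = (\<Sum>a\<in>A. sum u (Poly_Mapping.keys (v a)))"
  by (induction A rule: infinite_finite_induct) (auto simp: sum_keys_add bit_add_self)

text \<open>The Fredholm alternative for a possibly infinite system: each \<open>x\<close> gives one
  equation for the unknown \<open>w\<close>, and a solution exists if \<open>z\<close> respects
  every finite dependency of the left hand sides. With \<open>b k x\<close> the \<open>k\<close>-th
  face of \<open>x\<close>, a cochain that vanishes on all cycles modulo 2 is a coboundary.\<close>

lemma linear_system_mod2_solvable:
  fixes b :: "'i \<Rightarrow> 'x \<Rightarrow> 'y" and z :: "'x \<Rightarrow> bit"
  assumes I: "finite I"
    and dep: "\<And>A. \<lbrakk>finite A; A \<subseteq> P; \<And>u :: 'y \<Rightarrow> bit. (\<Sum>x\<in>A. \<Sum>k\<in>I. u (b k x)) = 0\<rbrakk> \<Longrightarrow> sum z A = 0"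
  shows "\<exists>w. \<forall>x\<in>P. z x = (\<Sum>k\<in>I. w (b k x))"
proof -
  let ?s1 = "\<lambda>(c::bit) (m :: 'x \<Rightarrow>\<^sub>0 bit). if c = 0 then 0 else m"
  let ?s2 = "\<lambda>(c::bit) (m :: 'y \<Rightarrow>\<^sub>0 bit). if c = 0 then 0 else m"
  have two: "m + m = 0" for m :: "'k \<Rightarrow>\<^sub>0 bit"
    by (rule poly_mapping_eqI) (simp add: lookup_add bit_add_self)
  have vs: "vector_space (\<lambda>(c::bit) (m :: 'k \<Rightarrow>\<^sub>0 bit). if c = 0 then 0 else m)"
  proof
    fix c d :: bit and x y :: "'k \<Rightarrow>\<^sub>0 bit"
    show "(if c + d = 0 then 0 else x) = (if c = 0 then 0 else x) + (if d = 0 then 0 else x)"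
      by (cases c; cases d; simp add: two)
  qed auto
  interpret vp: vector_space_pair ?s1 ?s2
    by (intro vector_space_pair.intro vs)
  \<comment> \<open>The boundary operator on the free vector space; \<open>dep\<close> says that
    \<open>z\<close> vanishes on the part of its kernel supported in \<open>P\<close>.\<close>
  define f where "f m = (\<Sum>x\<in>Poly_Mapping.keys m. \<Sum>k\<in>I. Poly_Mapping.single (b k x) (1::bit))" for m :: "'x \<Rightarrow>\<^sub>0 bit"
  interpret f: Vector_Spaces.linear ?s1 ?s2 f
  proof
    fix m n c
    show "f (m + n) = f m + f n"
      unfolding f_def by (rule sum_keys_add) (rule two)
    show "f (?s1 c m) = ?s2 c (f m)" by (auto simp: f_def)
  qed
  let ?V = "{m :: 'x \<Rightarrow>\<^sub>0 bit. Poly_Mapping.keys m \<subseteq> P}"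
  have V: "vp.vs1.subspace ?V"
    using Poly_Mapping.keys_add by (fastforce simp: vp.vs1.subspace_def)
  obtain g where g: "range g \<subseteq> ?V" "Vector_Spaces.linear ?s2 ?s1 g" "\<forall>v\<in>f ` ?V. f (g v) = v"
    using vp.linear_exists_right_inverse_on[OF f.linear_axioms V] by auto
  interpret g: Vector_Spaces.linear ?s2 ?s1 g by (rule g(2))
  have ker: "sum z (Poly_Mapping.keys m) = 0" if m: "m \<in> ?V" "f m = 0" for m
  proof (rule dep)
    fix u :: "'y \<Rightarrow> bit"
    have "sum u (Poly_Mapping.keys (f m)) = (\<Sum>x\<in>Poly_Mapping.keys m. \<Sum>k\<in>I. u (b k x))"
      by (simp add: f_def sum_keys_sum)
    then show "(\<Sum>x\<in>Poly_Mapping.keys m. \<Sum>k\<in>I. u (b k x)) = 0"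
      using m by simp
  qed (use m in auto)
  \<comment> \<open>\<open>g\<close> inverts \<open>f\<close> only on the image of \<open>?V\<close>
    but is linear on the whole space, so \<open>z\<close> composed with \<open>g\<close> needs no
    further extension.\<close>
  define w where "w y = sum z (Poly_Mapping.keys (g (Poly_Mapping.single y 1)))" for y
  have "z x = (\<Sum>k\<in>I. w (b k x))" if x: "x \<in> P" for x
  proof -
    let ?e = "Poly_Mapping.single x (1::bit)"
    have e: "?e \<in> ?V" using x by simp
    have ge: "g (f ?e) \<in> ?V" using g(1) by blast
    have "f (g (f ?e)) = f ?e" using g(3) e by blast
    then have "f (g (f ?e) + ?e) = 0"
      using two by (simp add: f.add)
    moreover have "g (f ?e) + ?e \<in> ?V"
      using vp.vs1.subspace_add[OF V ge e] .
    ultimately have "sum z (Poly_Mapping.keys (g (f ?e) + ?e)) = 0"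
      by (rule ker[rotated])
    then have "sum z (Poly_Mapping.keys (g (f ?e))) + z x = 0"
      by (simp add: sum_keys_add bit_add_self)
    then have "z x = sum z (Poly_Mapping.keys (g (f ?e)))"
      by (simp add: bit_add_eq_0_iff)
    also have "\<dots> = (\<Sum>k\<in>I. w (b k x))"
      by (simp add: f_def g.sum sum_keys_sum w_def)
    finally show ?thesis .
  qed
  then show ?thesis by blast
qed

text \<open>Derandomised coin flip: changing \<open>c\<close> at one point \<open>x\<close> flips
  the total for exactly those \<open>s\<close> with \<open>x\<close> in \<open>\<phi> s\<close>, so
  one of the two values leaves at most half of these with total 1. As \<open>\<phi> s\<close> is
  nonempty, every \<open>s\<close> is reached at some point.\<close>

lemma exists_halving_assignment:
  fixes \<phi> :: "'s \<Rightarrow> 'y set" and \<beta> :: "'s \<Rightarrow> bit"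
  assumes F: "finite F" and R: "finite R" and \<phi>: "\<And>s. s \<in> R \<Longrightarrow> \<phi> s \<subseteq> F \<and> \<phi> s \<noteq> {}"
  shows "\<exists>c. (\<forall>y. y \<notin> F \<longrightarrow> c y = 0) \<and> 2 * card {s\<in>R. \<beta> s + sum c (\<phi> s) = 1} \<le> card R"
  using F R \<phi>
proof (induction F arbitrary: R)
  case empty
  then have "R = {}" by auto
  then show ?case by auto
next
  case (insert x F)
  define R0 where "R0 = {s\<in>R. x \<notin> \<phi> s}"
  define R1 where "R1 = {s\<in>R. x \<in> \<phi> s}"
  have R: "R = R0 \<union> R1" "R0 \<inter> R1 = {}" "finite R0" "finite R1"
    using insert.prems by (auto simp: R0_def R1_def)
  \<comment> \<open>The values on \<open>F\<close> are fixed for the sake of the \<open>s\<close>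
    that do not involve \<open>x\<close>; the value at \<open>x\<close> is then free to serve the
    others.\<close>
  obtain c where c: "\<And>y. y \<notin> F \<Longrightarrow> c y = 0" "2 * card {s\<in>R0. \<beta> s + sum c (\<phi> s) = 1} \<le> card R0"
  proof -
    have "\<phi> s \<subseteq> F \<and> \<phi> s \<noteq> {}" if "s \<in> R0" for s
      using that insert.prems(2)[of s] by (auto simp: R0_def)
    from insert.IH[OF R(3) this] show ?thesis using that by blast
  qed
  define c' where "c' e = c(x := e)" for e
  have val: "sum (c' e) (\<phi> s) = e + sum c (\<phi> s - {x})" if "s \<in> R1" for s e
  proof -
    have "\<phi> s \<subseteq> insert x F" using insert.prems(2)[of s] that by (simp add: R1_def)
    then have "finite (\<phi> s)" using insert.hyps(1) finite_subset by blast
    then have "sum (c' e) (\<phi> s) = c' e x + sum (c' e) (\<phi> s - {x})"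
      using that by (intro sum.remove) (auto simp: R1_def)
    also have "sum (c' e) (\<phi> s - {x}) = sum c (\<phi> s - {x})"
      by (rule sum.cong) (auto simp: c'_def)
    finally show ?thesis by (simp add: c'_def)
  qed
  define T where "T e = {s\<in>R1. \<beta> s + sum (c' e) (\<phi> s) = 1}" for e
  have "T 0 \<inter> T 1 = {}"
  proof -
    have "\<not> (a + (0 + t) = 1 \<and> a + (1 + t) = 1)" for a t :: bit by (cases a; cases t; simp)
    then show ?thesis using val by (auto simp: T_def)
  qed
  moreover have fT: "finite (T e)" for e using R by (auto simp: T_def)
  ultimately have "card (T 0) + card (T 1) = card (T 0 \<union> T 1)"
    by (simp add: card_Un_disjoint)
  also have "\<dots> \<le> card R1" using R by (intro card_mono) (auto simp: T_def)
  finally have "2 * card (T 0) \<le> card R1 \<or> 2 * card (T 1) \<le> card R1" by linarith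
  then obtain e where e: "2 * card (T e) \<le> card R1" by blast
  have eq: "{s\<in>R. \<beta> s + sum (c' e) (\<phi> s) = 1} = {s\<in>R0. \<beta> s + sum c (\<phi> s) = 1} \<union> T e"
  proof -
    have "sum (c' e) (\<phi> s) = sum c (\<phi> s)" if "s \<in> R0" for s
      using that by (intro sum.cong) (auto simp: R0_def c'_def)
    then show ?thesis unfolding R T_def by auto
  qed
  have "card {s\<in>R. \<beta> s + sum (c' e) (\<phi> s) = 1} \<le> card {s\<in>R0. \<beta> s + sum c (\<phi> s) = 1} + card (T e)"
    unfolding eq by (rule card_Un_le)
  moreover have "card R = card R0 + card R1"
    using R by (simp add: card_Un_disjoint)
  ultimately have "2 * card {s\<in>R. \<beta> s + sum (c' e) (\<phi> s) = 1} \<le> card R"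
    using c(2) e by linarith
  moreover have "\<forall>y. y \<notin> insert x F \<longrightarrow> c' e y = 0" using c(1) by (auto simp: c'_def)
  ultimately show ?case by blast
qed

section \<open>Cochains on words\<close>

definition delete_nth :: "nat \<Rightarrow> 'v list \<Rightarrow> 'v list" where
  "delete_nth k t = take k t @ drop (Suc k) t"

lemma length_delete_nth: "k < length t \<Longrightarrow> length (delete_nth k t) = length t - 1"
  by (simp add: delete_nth_def)

lemma nth_delete_nth: "\<lbrakk>k < length t; i < length t - 1\<rbrakk> \<Longrightarrow> delete_nth k t ! i = t ! skip k i"
  by (auto simp: delete_nth_def nth_append min_def)

lemma delete_nth_Cons: "delete_nth 0 (b # t) = t" "delete_nth (Suc k) (b # t) = b # delete_nth k t"
  by (simp_all add: delete_nth_def)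

lemma set_delete_nth: "set (delete_nth k t) \<subseteq> set t"
  using set_take_subset[of k t] set_drop_subset[of "Suc k" t] by (auto simp: delete_nth_def)

lemma mset_delete_nth:
  assumes "k < length t"
  shows "mset (delete_nth k t) = mset t - {#t ! k#}"
proof -
  have "mset t = mset (take k t @ t ! k # drop (Suc k) t)"
    using id_take_nth_drop[OF assms] by simp
  then show ?thesis by (simp add: delete_nth_def)
qed

text \<open>A word of length \<open>Suc p\<close> stands for an affine \<open>p\<close>-simplex, and
  a cochain is a function on words of all lengths at once. Since the empty word counts, this is the
  augmented coboundary.\<close>

definition word_coboundary :: "('v list \<Rightarrow> bit) \<Rightarrow> 'v list \<Rightarrow> bit" where
  "word_coboundary z t = (\<Sum>k<length t. z (delete_nth k t))"

lemma word_coboundary_add: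
  "word_coboundary (\<lambda>u. z u + y u) t = word_coboundary z t + word_coboundary y t"
  by (simp add: word_coboundary_def sum.distrib)

text \<open>The coning identity: the boundary of a cone with apex \<open>b\<close> is its base plus
  the cone over the boundary of the base.\<close>

lemma word_coboundary_Cons:
  "word_coboundary z (b # t) = z t + word_coboundary (\<lambda>u. z (b # u)) t"
  by (simp add: word_coboundary_def sum.lessThan_Suc_shift delete_nth_Cons del: sum.lessThan_Suc)

lemma word_coboundary_twice: "word_coboundary (word_coboundary z) t = 0"
proof (induction t arbitrary: z)
  case (Cons b t)
  have "word_coboundary (word_coboundary z) (b # t)
      = word_coboundary z t + word_coboundary (\<lambda>u. z u + word_coboundary (\<lambda>u. z (b # u)) u) t"
    by (simp add: word_coboundary_Cons)
  also have "\<dots> = word_coboundary (word_coboundary (\<lambda>u. z (b # u))) t"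
    by (simp add: word_coboundary_add bit_add_self)
  finally show ?case by (simp add: Cons)
qed (simp add: word_coboundary_def)

text \<open>The trace of a total order on the finite sets. \<open>remove_enum\<close> is the
  compatibility with faces: deleting a vertex from an ordered simplex leaves an ordered
  simplex.\<close>

locale enumeration =
  fixes enum :: "'v set \<Rightarrow> 'v list"
  assumes set_enum [simp]: "finite W \<Longrightarrow> set (enum W) = W"
    and distinct_enum [simp]: "finite W \<Longrightarrow> distinct (enum W)"
    and remove_enum: "\<lbrakk>finite W; v \<in> W\<rbrakk> \<Longrightarrow> removeAll v (enum W) = enum (W - {v})"
begin

lemma length_enum [simp]: "finite W \<Longrightarrow> length (enum W) = card W"
  using distinct_card[of "enum W"] by simp

text \<open>The pullback of \<open>z\<close> along the sorting of words. Modulo 2 the sorting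
  permutation contributes no sign, and words with a repeated letter count as degenerate.\<close>

definition sorted_cochain :: "('v list \<Rightarrow> bit) \<Rightarrow> 'v list \<Rightarrow> bit" where
  "sorted_cochain z t = (if distinct t then z (enum (set t)) else 0)"

lemma delete_nth_distinct:
  assumes "distinct t" "k < length t"
  shows "delete_nth k t = removeAll (t ! k) t"
proof -
  have t: "t = take k t @ t ! k # drop (Suc k) t" using id_take_nth_drop[OF assms(2)] .
  then have "distinct (take k t @ t ! k # drop (Suc k) t)" using assms(1) by metis
  then have "removeAll (t ! k) (take k t @ t ! k # drop (Suc k) t) = take k t @ drop (Suc k) t"
    by simp
  then show ?thesis using t by (simp add: delete_nth_def)
qed

lemma word_coboundary_distinct:
  assumes "distinct t"
  shows "word_coboundary z t = (\<Sum>v\<in>set t. z (removeAll v t))"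
proof -
  have "word_coboundary z t = (\<Sum>k<length t. z (removeAll (t ! k) t))"
    unfolding word_coboundary_def using assms by (intro sum.cong) (auto simp: delete_nth_distinct)
  also have "\<dots> = (\<Sum>v\<in>set t. z (removeAll v t))"
    by (rule sum.reindex_bij_betw[OF bij_betw_nth[OF assms refl refl]])
  finally show ?thesis .
qed

text \<open>If \<open>t\<close> has a repeated letter, then only deleting one of two equal letters can produce a
  word with distinct letters, and these two contributions cancel.\<close>

lemma word_coboundary_sorted_cochain:
  "word_coboundary (sorted_cochain z) t = sorted_cochain (word_coboundary z) t"
proof (cases "distinct t")
  case True
  have "word_coboundary (sorted_cochain z) t = (\<Sum>v\<in>set t. sorted_cochain z (removeAll v t))"
    using True by (rule word_coboundary_distinct)
  also have "\<dots> = (\<Sum>v\<in>set t. z (removeAll v (enum (set t))))"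
    using True by (intro sum.cong refl) (simp add: sorted_cochain_def distinct_removeAll remove_enum)
  also have "\<dots> = word_coboundary z (enum (set t))"
    by (simp add: word_coboundary_distinct)
  finally show ?thesis using True by (simp add: sorted_cochain_def)
next
  case False
  then obtain i j where ij: "i < length t" "j < length t" "i \<noteq> j" "t ! i = t ! j"
    unfolding distinct_conv_nth by blast
  let ?y = "\<lambda>k. sorted_cochain z (delete_nth k t)"
  have zero: "?y k = 0" if k: "k < length t" "k \<noteq> i" "k \<noteq> j" for k
  proof -
    \<comment> \<open>\<open>r\<close> inverts \<open>skip k\<close>: it is the position of the
      \<open>l\<close>-th letter after the deletion, so the equal letters at \<open>i\<close> and
      \<open>j\<close> both survive.\<close>
    define r where "r l = (if l < k then l else l - 1)" for l :: nat
    have "r l < length (delete_nth k t) \<and> delete_nth k t ! r l = t ! l" if "l < length t" "l \<noteq> k" for l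
      using that k by (auto simp: r_def length_delete_nth nth_delete_nth)
    moreover have "r i \<noteq> r j" using ij k by (auto simp: r_def split: if_splits)
    ultimately have "\<not> distinct (delete_nth k t)"
      using ij k nth_eq_iff_index_eq by metis
    then show ?thesis by (simp add: sorted_cochain_def)
  qed
  have "mset (delete_nth i t) = mset (delete_nth j t)"
    using ij by (simp add: mset_delete_nth)
  then have eq: "?y i = ?y j"
    using mset_eq_imp_distinct_iff mset_eq_setD unfolding sorted_cochain_def by metis
  have "word_coboundary (sorted_cochain z) t = (\<Sum>k\<in>{i, j}. ?y k)"
    unfolding word_coboundary_def using ij zero by (intro sum.mono_neutral_right) auto
  also have "\<dots> = 0" using ij eq by (simp add: bit_add_self)
  finally show ?thesis using False by (simp add: sorted_cochain_def)
qed

text \<open>The dual of the chain homotopy between the identity and the sorting operator \<open>\<pi>\<close> on words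
  which is given recursively by \<open>h t = b (t - \<pi> t - h (\<partial> t))\<close>, where \<open>b\<close> is the first letter
  of \<open>t\<close>.\<close>

function sorting_homotopy :: "('v list \<Rightarrow> bit) \<Rightarrow> 'v list \<Rightarrow> bit" where
  "sorting_homotopy z [] = 0"
| "sorting_homotopy z (b # t) =
    z (b # b # t) + sorted_cochain (\<lambda>u. z (b # u)) (b # t)
    + (\<Sum>k<Suc (length t). sorting_homotopy (\<lambda>u. z (b # u)) (delete_nth k (b # t)))"
  by pat_completeness auto
termination
  by (relation "measure (\<lambda>(z, t). length t)") (auto simp: length_delete_nth)

declare sorting_homotopy.simps(2) [simp del]

lemma sorting_homotopy_Cons:
  "sorting_homotopy z (b # t) =
    z (b # b # t) + sorted_cochain (\<lambda>u. z (b # u)) (b # t)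
    + word_coboundary (sorting_homotopy (\<lambda>u. z (b # u))) (b # t)"
  by (simp add: sorting_homotopy.simps(2) word_coboundary_def)

lemma sorted_cochain_add:
  "sorted_cochain (\<lambda>u. z u + y u) t = sorted_cochain z t + sorted_cochain y t"
  by (simp add: sorted_cochain_def)

lemma sorting_homotopy_add:
  "sorting_homotopy (\<lambda>u. z u + y u) t = sorting_homotopy z t + sorting_homotopy y t"
proof (induction "length t" arbitrary: t z y rule: less_induct)
  case less
  show ?case
  proof (cases t)
    case (Cons b s)
    have "word_coboundary (sorting_homotopy (\<lambda>u. z (b # u) + y (b # u))) t
        = word_coboundary (\<lambda>u. sorting_homotopy (\<lambda>u. z (b # u)) u + sorting_homotopy (\<lambda>u. y (b # u)) u) t"
      unfolding word_coboundary_def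
      by (intro sum.cong refl less) (auto simp: length_delete_nth)
    then show ?thesis
      by (simp add: Cons sorting_homotopy_Cons sorted_cochain_add word_coboundary_add add_ac)
  qed simp
qed

text \<open>The homotopy stays in the simplex spanned by the letters of \<open>t\<close>, so it can
  be used cell by cell and does not depend on the cell that carries the word.\<close>

lemma sorting_homotopy_cong:
  assumes "\<And>u. set u \<subseteq> set t \<Longrightarrow> z u = y u"
  shows "sorting_homotopy z t = sorting_homotopy y t"
  using assms
proof (induction "length t" arbitrary: t z y rule: less_induct)
  case less
  show ?case
  proof (cases t)
    case (Cons b s)
    have "word_coboundary (sorting_homotopy (\<lambda>u. z (b # u))) t
        = word_coboundary (sorting_homotopy (\<lambda>u. y (b # u))) t"
      unfolding word_coboundary_def
    proof (intro sum.cong refl less(1))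
      fix k u assume "k \<in> {..<length t}" "set u \<subseteq> set (delete_nth k t)"
      then show "z (b # u) = y (b # u)"
        using set_delete_nth[of k t] Cons by (intro less) auto
    qed (auto simp: length_delete_nth)
    moreover have "z (b # t) = y (b # t)" "z (b # enum (set t)) = y (b # enum (set t))"
      using Cons by (auto intro!: less)
    ultimately show ?thesis
      unfolding Cons sorting_homotopy_Cons by (simp add: sorted_cochain_def)
  qed simp
qed

lemma sorting_homotopy:
  "word_coboundary (sorting_homotopy z) t + sorting_homotopy (word_coboundary z) t = z t + sorted_cochain z t"
proof (induction "length t" arbitrary: t z rule: less_induct)
  case less
  show ?case
  proof (cases t)
    case Nil
    have "enum {} = []" using set_enum[of "{}"] by (metis finite.emptyI set_empty)
    then show ?thesis by (simp add: Nil word_coboundary_def sorted_cochain_def bit_add_self)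
  next
    case (Cons b s)
    let ?z = "\<lambda>u. z (b # u)"
    \<comment> \<open>Induction applies to the facets of \<open>t\<close>, with \<open>?z\<close> in
      place of \<open>z\<close>; what remains besides the two wanted terms is a double
      coboundary.\<close>
    have "word_coboundary (sorting_homotopy (word_coboundary ?z)) t
        = word_coboundary (\<lambda>u. (?z u + sorted_cochain ?z u) + word_coboundary (sorting_homotopy ?z) u) t"
      unfolding word_coboundary_def[of _ t]
    proof (intro sum.cong refl)
      fix k assume "k \<in> {..<length t}"
      then have "word_coboundary (sorting_homotopy ?z) (delete_nth k t)
          + sorting_homotopy (word_coboundary ?z) (delete_nth k t)
          = ?z (delete_nth k t) + sorted_cochain ?z (delete_nth k t)"
        by (intro less) (auto simp: length_delete_nth)
      then show "sorting_homotopy (word_coboundary ?z) (delete_nth k t)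
          = (?z (delete_nth k t) + sorted_cochain ?z (delete_nth k t))
            + word_coboundary (sorting_homotopy ?z) (delete_nth k t)"
        by (metis add.commute bit_add_self(2))
    qed
    also have "\<dots> = word_coboundary ?z t + sorted_cochain (word_coboundary ?z) t"
      by (simp only: word_coboundary_add word_coboundary_sorted_cochain word_coboundary_twice add_0_right)
    finally have 1: "word_coboundary (sorting_homotopy (word_coboundary ?z)) t
        = word_coboundary ?z t + sorted_cochain (word_coboundary ?z) t" .
    have "sorting_homotopy (word_coboundary z) t
        = (z t + word_coboundary ?z t) + (sorted_cochain z t + sorted_cochain (word_coboundary ?z) t)
          + (word_coboundary (sorting_homotopy z) t + word_coboundary (sorting_homotopy (word_coboundary ?z)) t)"
    proof -
      have "(\<lambda>u. word_coboundary z (b # u)) = (\<lambda>u. z u + word_coboundary ?z u)"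
        by (simp add: word_coboundary_Cons fun_eq_iff)
      moreover have "sorting_homotopy (\<lambda>u. z u + word_coboundary ?z u)
          = (\<lambda>u. sorting_homotopy z u + sorting_homotopy (word_coboundary ?z) u)"
        by (simp add: fun_eq_iff sorting_homotopy_add)
      ultimately show ?thesis
        using word_coboundary_Cons[of z b t]
        by (simp add: Cons sorting_homotopy_Cons sorted_cochain_add word_coboundary_add)
    qed
    then show ?thesis unfolding 1 by (simp add: add_ac bit_add_self)
  qed
qed

end

lemma enumeration_exists: "\<exists>enum :: 'v set \<Rightarrow> 'v list. enumeration enum"
proof -
  obtain r :: "'v rel" where r: "well_order_on UNIV r" using well_order_on by blast
  define le where "le x y \<longleftrightarrow> (x, y) \<in> r" for x y
  define lt where "lt x y \<longleftrightarrow> le x y \<and> x \<noteq> y" for x y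
  \<comment> \<open>Any total order would do. The type of vertices comes with none, so a well-order
    is interpreted locally and provides \<open>sorted_list_of_set\<close>.\<close>
  interpret L: linorder le lt
  proof
    have refl: "(x, x) \<in> r" and antisym: "antisym r" and trans: "trans r"
      and total: "total r" for x
      using r by (auto simp: well_order_on_def linear_order_on_def partial_order_on_def
          preorder_on_def refl_on_def)
    show "le x x" for x using refl by (simp add: le_def)
    then show "lt x y \<longleftrightarrow> le x y \<and> \<not> le y x" for x y
      using antisymD[OF antisym, of x y] unfolding lt_def le_def by blast
    show "le x y \<or> le y x" for x y
      using total refl unfolding le_def total_on_def by (cases "x = y") auto
    show "le x z" if "le x y" "le y z" for x y z
      using that transD[OF trans] by (simp add: le_def)
    show "x = y" if "le x y" "le y x" for x y
      using that antisymD[OF antisym] by (simp add: le_def)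
  qed
  have "enumeration L.sorted_list_of_set"
    by unfold_locales (simp_all add: L.sorted_list_of_set_remove distinct_remove1_removeAll)
  then show ?thesis by blast
qed

section \<open>Barycentric coordinates in a simplicial cell complex\<close>

text \<open>The geometric simplex on \<open>W\<close>. Coordinates are indexed by the vertices
  themselves and vanish off \<open>W\<close>, so that a face uses the same coordinates as the
  simplex containing it.\<close>

definition weights :: "'v set \<Rightarrow> ('v \<Rightarrow> real) set" where
  "weights W = {A. (\<forall>v. 0 \<le> A v) \<and> (\<forall>v. v \<notin> W \<longrightarrow> A v = 0) \<and> sum A W = 1}"

definition supp :: "('v \<Rightarrow> real) \<Rightarrow> 'v set" where
  "supp A = {v. A v \<noteq> 0}"

lemma weights_supp:
  assumes "A \<in> weights W" "finite W"
  shows "supp A \<subseteq> W" "supp A \<noteq> {}" "A \<in> weights (supp A)" "v \<in> supp A \<longleftrightarrow> 0 < A v"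
proof -
  show 1: "supp A \<subseteq> W" using assms by (auto simp: weights_def supp_def)
  have "sum A (supp A) = sum A W"
    using 1 assms by (intro sum.mono_neutral_left) (auto simp: supp_def)
  then have sum1: "sum A (supp A) = 1" using assms by (simp add: weights_def)
  then show "supp A \<noteq> {}" by force
  show "A \<in> weights (supp A)"
    using assms sum1 by (auto simp: weights_def supp_def)
  show "v \<in> supp A \<longleftrightarrow> 0 < A v"
    using assms by (auto simp: weights_def supp_def less_le)
qed

lemma weights_mono:
  assumes "W \<subseteq> W'" "finite W'"
  shows "weights W \<subseteq> weights W'"
proof
  fix A assume A: "A \<in> weights W"
  then have "sum A W = sum A W'"
    using assms by (intro sum.mono_neutral_left) (auto simp: weights_def)
  then show "A \<in> weights W'" using A assms(1) by (auto simp: weights_def)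
qed

lemma weights_convex:
  assumes "A \<in> weights W" "B \<in> weights W" "0 \<le> t" "t \<le> 1"
  shows "(\<lambda>v. (1 - t) * A v + t * B v) \<in> weights W"
  using assms by (auto simp: weights_def sum.distrib simp flip: sum_distrib_left)

lemma weights_le_1: "\<lbrakk>A \<in> weights W; finite W\<rbrakk> \<Longrightarrow> A v \<le> 1"
  by (cases "v \<in> W") (auto simp: weights_def dest: member_le_sum[of v W A])

definition word_weights :: "'v list \<Rightarrow> (nat \<Rightarrow> real) \<Rightarrow> 'v \<Rightarrow> real" where
  "word_weights w x v = (\<Sum>i<length w. if w ! i = v then x i else 0)"

lemma word_weights_in:
  assumes x: "x \<in> standard_simplex (length w - 1)" and w: "w \<noteq> []"
  shows "word_weights w x \<in> weights (set w)"
proof -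
  have x0: "\<And>i. 0 \<le> x i" and x1: "sum x {..length w - 1} = 1"
    using x by (auto simp: standard_simplex_def)
  have "{..length w - 1} = {..<length w}" using w by (cases w) auto
  then have x1: "sum x {..<length w} = 1" using x1 by simp
  have "(\<Sum>v\<in>set w. word_weights w x v) = (\<Sum>i<length w. \<Sum>v\<in>set w. if w ! i = v then x i else 0)"
    unfolding word_weights_def by (rule sum.swap)
  also have "\<dots> = sum x {..<length w}" by (intro sum.cong) auto
  finally show ?thesis
    using x0 x1 by (auto simp: weights_def word_weights_def intro!: sum_nonneg sum.neutral)
qed

lemma supp_word_weights:
  assumes "\<And>i. i < length w \<Longrightarrow> 0 < x i"
  shows "supp (word_weights w x) = set w"
proof -
  have "word_weights w x v \<noteq> 0 \<longleftrightarrow> v \<in> set w" for v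
  proof -
    have "word_weights w x v = 0 \<longleftrightarrow> (\<forall>i\<in>{..<length w}. (if w ! i = v then x i else 0) = 0)"
      unfolding word_weights_def using assms by (intro sum_nonneg_eq_0_iff) (auto intro: less_imp_le)
    then show ?thesis using assms by (auto simp: in_set_conv_nth less_le split: if_splits)
  qed
  then show ?thesis by (auto simp: supp_def)
qed

lemma word_weights_vertex:
  assumes "i < length w"
  shows "word_weights w (\<lambda>j. if j = i then 1 else 0) = (\<lambda>v. if v = w ! i then 1 else 0)"
proof
  fix v
  have "word_weights w (\<lambda>j. if j = i then 1 else 0) v = (\<Sum>j<length w. if j = i then (if w ! i = v then 1 else 0) else 0)"
    unfolding word_weights_def by (intro sum.cong) auto
  also have "\<dots> = (if v = w ! i then 1 else 0)" using assms by auto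
  finally show "word_weights w (\<lambda>j. if j = i then 1 else 0) v = (if v = w ! i then 1 else 0)" .
qed

lemma affine_vertex_map_vertex:
  assumes "i \<le> p"
  shows "affine_vertex_map p v (\<lambda>j. if j = i then 1 else 0) = (\<lambda>k. if k = v i then 1 else 0)"
proof
  fix k
  have x: "(\<lambda>j. if j = i then 1 else (0::real)) \<in> standard_simplex p" using assms by simp
  have "(\<Sum>j | j \<le> p \<and> v j = k. if j = i then 1 else (0::real)) = (\<Sum>j\<in>{j. j \<le> p \<and> v j = k} \<inter> {i}. 1)"
    by (subst sum.inter_restrict) auto
  also have "{j. j \<le> p \<and> v j = k} \<inter> {i} = (if k = v i then {i} else {})" using assms by auto
  finally show "affine_vertex_map p v (\<lambda>j. if j = i then 1 else 0) k = (if k = v i then 1 else 0)"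
    by (simp add: affine_vertex_map_apply[OF x])
qed

context simplicial_cell_complex
begin

abbreviation closed_cell :: "'c \<Rightarrow> 'b set" where
  "closed_cell s \<equiv> \<Phi> s ` standard_simplex (sdim s)"

definition vertex :: "'c \<Rightarrow> nat \<Rightarrow> 'b" where
  "vertex s i = \<Phi> s (\<lambda>j. if j = i then 1 else 0)"

definition verts :: "'c \<Rightarrow> 'b set" where
  "verts s = vertex s ` {..sdim s}"

definition vertex_index :: "'c \<Rightarrow> 'b \<Rightarrow> nat" where
  "vertex_index s = inv_into {..sdim s} (vertex s)"

text \<open>The cell is part of the data: cells with the same vertices can yield different points
  for the same weights.\<close>

definition point :: "'c \<Rightarrow> ('b \<Rightarrow> real) \<Rightarrow> 'b" where
  "point s A = \<Phi> s (\<lambda>i. if i \<le> sdim s then A (vertex s i) else 0)"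

lemma finite_verts [simp]: "finite (verts s)"
  by (simp add: verts_def)

lemma verts_nonempty [simp]: "verts s \<noteq> {}"
  by (simp add: verts_def)

lemma inj_vertex:
  assumes "s \<in> S"
  shows "inj_on (vertex s) {..sdim s}"
proof (rule inj_onI)
  fix i j assume ij: "i \<in> {..sdim s}" "j \<in> {..sdim s}" "vertex s i = vertex s j"
  then have "(\<lambda>k. if k = i then 1 else 0) = (\<lambda>k. if k = j then 1 else (0::real))"
    using characteristic_inj[OF assms] by (auto simp: vertex_def dest!: inj_onD)
  then show "i = j" by (metis zero_neq_one)
qed

lemma vertex_index:
  assumes "s \<in> S"
  shows "i \<le> sdim s \<Longrightarrow> vertex_index s (vertex s i) = i"
    and "v \<in> verts s \<Longrightarrow> vertex_index s v \<le> sdim s \<and> vertex s (vertex_index s v) = v"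
proof -
  show "i \<le> sdim s \<Longrightarrow> vertex_index s (vertex s i) = i"
    unfolding vertex_index_def by (rule inv_into_f_f[OF inj_vertex[OF assms]]) simp
  assume "v \<in> verts s"
  then show "vertex_index s v \<le> sdim s \<and> vertex s (vertex_index s v) = v"
    using inv_into_into[of v "vertex s" "{..sdim s}"] f_inv_into_f[of v "vertex s" "{..sdim s}"]
    by (simp add: verts_def vertex_index_def)
qed

lemma card_verts: "s \<in> S \<Longrightarrow> card (verts s) = Suc (sdim s)"
  by (simp add: verts_def card_image inj_vertex)

lemma sum_verts: "s \<in> S \<Longrightarrow> sum A (verts s) = (\<Sum>i\<le>sdim s. A (vertex s i))"
  by (simp add: verts_def sum.reindex inj_vertex)

lemma weights_imp_simplex:
  assumes "s \<in> S" "A \<in> weights (verts s)"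
  shows "(\<lambda>i. if i \<le> sdim s then A (vertex s i) else 0) \<in> standard_simplex (sdim s)"
  using assms weights_le_1[OF assms(2)]
  by (auto simp: standard_simplex_def weights_def sum_verts)

lemma point_in_closed_cell:
  "\<lbrakk>s \<in> S; A \<in> weights (verts s)\<rbrakk> \<Longrightarrow> point s A \<in> closed_cell s"
  unfolding point_def by (intro imageI weights_imp_simplex)

lemma closed_cell_subset: "s \<in> S \<Longrightarrow> closed_cell s \<subseteq> topspace Y"
  using characteristic_map[of s] by (auto simp: singular_simplex_def continuous_map_def)

lemma point_in_topspace:
  "\<lbrakk>s \<in> S; A \<in> weights (verts s)\<rbrakk> \<Longrightarrow> point s A \<in> topspace Y"
  using point_in_closed_cell closed_cell_subset by blast

definition simplex_weights :: "'c \<Rightarrow> (nat \<Rightarrow> real) \<Rightarrow> 'b \<Rightarrow> real" where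
  "simplex_weights s x v = (if v \<in> verts s then x (vertex_index s v) else 0)"

lemma simplex_weights:
  assumes s: "s \<in> S" and x: "x \<in> standard_simplex (sdim s)"
  shows "simplex_weights s x \<in> weights (verts s)" "point s (simplex_weights s x) = \<Phi> s x"
    and "x \<in> open_standard_simplex (sdim s) \<longleftrightarrow> supp (simplex_weights s x) = verts s"
proof -
  have *: "simplex_weights s x (vertex s i) = x i" if "i \<le> sdim s" for i
    using that s by (simp add: simplex_weights_def vertex_index verts_def)
  show "simplex_weights s x \<in> weights (verts s)"
    using x by (auto simp: weights_def sum_verts[OF s] * standard_simplex_def)
       (auto simp: simplex_weights_def)
  have "(\<lambda>i. if i \<le> sdim s then simplex_weights s x (vertex s i) else 0) = x"
    using x by (auto simp: * standard_simplex_def)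
  then show "point s (simplex_weights s x) = \<Phi> s x"
    by (simp add: point_def)
  have "supp (simplex_weights s x) = verts s \<longleftrightarrow> (\<forall>v\<in>verts s. simplex_weights s x v \<noteq> 0)"
    by (auto simp: supp_def simplex_weights_def)
  also have "\<dots> \<longleftrightarrow> (\<forall>i\<le>sdim s. x i \<noteq> 0)"
    by (auto simp: verts_def *)
  also have "\<dots> \<longleftrightarrow> x \<in> open_standard_simplex (sdim s)"
    using x by (auto simp: open_standard_simplex_def standard_simplex_def less_le)
  finally show "x \<in> open_standard_simplex (sdim s) \<longleftrightarrow> supp (simplex_weights s x) = verts s" by simp
qed

lemma point_inj:
  assumes s: "s \<in> S" and A: "A \<in> weights (verts s)" and B: "B \<in> weights (verts s)"
    and eq: "point s A = point s B"
  shows "A = B"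
proof
  fix v
  have "(\<lambda>i. if i \<le> sdim s then A (vertex s i) else 0) = (\<lambda>i. if i \<le> sdim s then B (vertex s i) else 0)"
    using characteristic_inj[OF s] eq weights_imp_simplex[OF s] A B
    unfolding point_def inj_on_def by blast
  then have "A (vertex s i) = B (vertex s i)" if "i \<le> sdim s" for i
    using that by (metis (mono_tags, lifting))
  then show "A v = B v"
    using A B by (cases "v \<in> verts s") (auto simp: verts_def weights_def)
qed

lemma point_vertex:
  assumes "s \<in> S" "v \<in> verts s"
  shows "point s (\<lambda>u. if u = v then 1 else 0) = v"
proof -
  have "(\<lambda>i. if i \<le> sdim s then (if vertex s i = v then 1 else 0) else (0::real))
      = (\<lambda>j. if j = vertex_index s v then 1 else 0)"
  proof
    fix i
    show "(if i \<le> sdim s then (if vertex s i = v then 1 else 0) else (0::real))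
      = (if i = vertex_index s v then 1 else 0)"
      using vertex_index(1)[OF assms(1), of i] vertex_index(2)[OF assms] by auto
  qed
  then have "point s (\<lambda>u. if u = v then 1 else 0) = vertex s (vertex_index s v)"
    by (simp add: point_def vertex_def)
  then show ?thesis using assms by (simp add: vertex_index)
qed

text \<open>The axiom \<open>simplicial_face\<close> freed from numberings: \<open>v\<close> is a
  bijection onto the indices of \<open>W\<close>, so vertex-indexed coordinates absorb it and the
  face inclusion becomes the identity on weights.\<close>

lemma face_exists:
  assumes s: "s \<in> S" and W: "W \<subseteq> verts s" "W \<noteq> {}"
  shows "\<exists>t\<in>S. verts t = W \<and> (\<forall>A\<in>weights W. point t A = point s A)"
proof -
  let ?J = "vertex_index s ` W"
  have J: "?J \<subseteq> {..sdim s}" "?J \<noteq> {}" using W vertex_index(2)[OF s] by auto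
  obtain t v where t: "t \<in> S" and v: "bij_betw v {..sdim t} ?J"
    and pull: "pull_vertices (sdim t) v (\<Phi> s) = \<Phi> t"
    using simplicial_face[OF s J] by blast
  have vJ: "v i \<in> ?J" if "i \<le> sdim t" for i using v that by (auto simp: bij_betw_def)
  have \<Phi>t: "\<Phi> t x = \<Phi> s (affine_vertex_map (sdim t) v x)" if "x \<in> standard_simplex (sdim t)" for x
    using that by (simp flip: pull add: pull_vertices_def simplex_map_def)
  \<comment> \<open>The fibres of \<open>v\<close> have at most one element, so the sum in
    \<open>affine_vertex_map_apply\<close> is a single coordinate or 0.\<close>
  have pick: "(\<Sum>j | j \<le> sdim t \<and> v j = k. x j) = (if k \<in> ?J then x (inv_into {..sdim t} v k) else 0)"
    for k and x :: "nat \<Rightarrow> real"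
  proof (cases "k \<in> ?J")
    case True
    then have "k \<in> v ` {..sdim t}" using v by (simp add: bij_betw_def)
    then obtain j where j: "j \<le> sdim t" "v j = k" by auto
    then have "{j. j \<le> sdim t \<and> v j = k} = {j}"
      using v by (auto simp: bij_betw_def inj_on_def)
    moreover have "inv_into {..sdim t} v k = j"
      using v j by (auto simp: bij_betw_def intro: inv_into_f_eq)
    ultimately show ?thesis using True by simp
  next
    case False
    then have "{j. j \<le> sdim t \<and> v j = k} = {}" using vJ by blast
    then show ?thesis using False by (simp only: sum.empty if_False)
  qed
  have vert: "vertex t i = vertex s (v i)" if "i \<le> sdim t" for i
    using that by (simp add: vertex_def \<Phi>t affine_vertex_map_vertex)
  have "verts t = vertex s ` v ` {..sdim t}" by (auto simp: verts_def vert)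
  also have "v ` {..sdim t} = ?J" using v by (simp add: bij_betw_def)
  also have "vertex s ` ?J = W" using W vertex_index(2)[OF s] by (force simp: image_image)
  finally have tW: "verts t = W" .
  have "point t A = point s A" if A: "A \<in> weights W" for A
  proof -
    have "A (vertex s k) = 0" if "k \<le> sdim s" "k \<notin> ?J" for k
    proof -
      have "vertex s k \<notin> W" using that vertex_index(1)[OF s, of k] by (metis imageI)
      then show ?thesis using A by (simp add: weights_def)
    qed
    moreover have "inv_into {..sdim t} v k \<le> sdim t \<and> v (inv_into {..sdim t} v k) = k" if "k \<in> ?J" for k
    proof -
      have "k \<in> v ` {..sdim t}" using v that by (simp add: bij_betw_def)
      then show ?thesis using inv_into_into[of k v "{..sdim t}"] f_inv_into_f[of k v "{..sdim t}"] by simp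
    qed
    ultimately have "(\<lambda>k. \<Sum>j | j \<le> sdim t \<and> v j = k. if j \<le> sdim t then A (vertex t j) else 0)
        = (\<lambda>k. if k \<le> sdim s then A (vertex s k) else 0)"
      unfolding pick using J(1) by (auto simp: vert fun_eq_iff)
    then show ?thesis
      using weights_imp_simplex[OF t, unfolded tW, OF A] by (simp add: point_def \<Phi>t affine_vertex_map_apply)
  qed
  then show ?thesis using t tW by blast
qed

text \<open>The carrier of \<open>y\<close>: the one cell whose interior contains it.\<close>

definition cell :: "'b \<Rightarrow> 'c" where
  "cell y = (THE s. s \<in> S \<and> y \<in> \<Phi> s ` open_standard_simplex (sdim s))"

definition coord :: "'b \<Rightarrow> 'b \<Rightarrow> real" where
  "coord y = (THE A. A \<in> weights (verts (cell y)) \<and> point (cell y) A = y)"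

lemma cell:
  assumes "y \<in> topspace Y"
  shows "cell y \<in> S" "y \<in> \<Phi> (cell y) ` open_standard_simplex (sdim (cell y))"
  using theI'[OF open_cells[OF assms]] by (auto simp: cell_def)

lemma coord_eq:
  assumes "y \<in> topspace Y" "A \<in> weights (verts (cell y))" "point (cell y) A = y"
  shows "coord y = A"
  unfolding coord_def
proof (rule the_equality)
  fix B assume "B \<in> weights (verts (cell y)) \<and> point (cell y) B = y"
  then show "B = A"
    using point_inj[OF cell(1)[OF assms(1)] _ assms(2)] assms(3) by metis
qed (simp add: assms)

lemma cell_point_open:
  assumes s: "s \<in> S" and A: "A \<in> weights (verts s)" "supp A = verts s"
  shows "cell (point s A) = s"
proof -
  let ?x = "\<lambda>i. if i \<le> sdim s then A (vertex s i) else 0"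
  have x: "?x \<in> standard_simplex (sdim s)" by (rule weights_imp_simplex[OF s A(1)])
  then have "point s (simplex_weights s ?x) = point s A"
    using simplex_weights(2)[OF s] by (simp add: point_def)
  then have "simplex_weights s ?x = A"
    using point_inj[OF s] simplex_weights(1)[OF s x] A by blast
  then have "?x \<in> open_standard_simplex (sdim s)"
    using simplex_weights(3)[OF s x] A by simp
  then have "point s A \<in> \<Phi> s ` open_standard_simplex (sdim s)" by (auto simp: point_def)
  then show ?thesis
    using open_cells[OF point_in_topspace[OF s A(1)]] cell[OF point_in_topspace[OF s A(1)]] s by blast
qed

lemma coord:
  assumes y: "y \<in> topspace Y"
  shows "coord y \<in> weights (verts (cell y))" "supp (coord y) = verts (cell y)" "point (cell y) (coord y) = y"
proof -
  obtain x where x: "x \<in> open_standard_simplex (sdim (cell y))" "y = \<Phi> (cell y) x"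
    using cell[OF y] by blast
  then have "x \<in> standard_simplex (sdim (cell y))" by (simp add: open_standard_simplex_def)
  note sw = simplex_weights[OF cell(1)[OF y] this]
  then have "coord y = simplex_weights (cell y) x"
    using coord_eq[OF y] x by simp
  then show "coord y \<in> weights (verts (cell y))" "supp (coord y) = verts (cell y)" "point (cell y) (coord y) = y"
    using sw x by auto
qed

text \<open>The face of \<open>s\<close> spanned by \<open>supp A\<close> has the point in its
  interior, so it is the carrier. Hence coordinates computed in any closed cell through a point
  agree with \<open>coord\<close>.\<close>

lemma coord_point:
  assumes s: "s \<in> S" and A: "A \<in> weights (verts s)"
  shows "coord (point s A) = A" "verts (cell (point s A)) = supp A"
    and "B \<in> weights (supp A) \<Longrightarrow> point (cell (point s A)) B = point s B"
proof -
  note W = weights_supp[OF A finite_verts]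
  obtain t where t: "t \<in> S" "verts t = supp A" "\<And>B. B \<in> weights (supp A) \<Longrightarrow> point t B = point s B"
    using face_exists[OF s W(1,2)] by blast
  have tA: "point t A = point s A" using t(3) W(3) by blast
  have cell: "cell (point s A) = t"
    using cell_point_open[OF t(1), of A] W(3) t(2) tA by metis
  then show "verts (cell (point s A)) = supp A"
    "B \<in> weights (supp A) \<Longrightarrow> point (cell (point s A)) B = point s B"
    using t by auto
  show "coord (point s A) = A"
    using coord_eq[OF point_in_topspace[OF s A], of A] cell W(3) t(2) tA by metis
qed

lemma cell_point_cong:
  assumes s: "s \<in> S" and A: "A \<in> weights (verts s)" and B: "B \<in> weights (verts s)"
    and eq: "supp A = supp B"
  shows "cell (point s A) = cell (point s B)"
proof -
  let ?c = "cell (point s A)"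
  note W = weights_supp[OF A finite_verts] weights_supp[OF B finite_verts]
  have v: "verts ?c = supp B" using coord_point(2)[OF s A] eq by simp
  have "point ?c B = point s B"
    using coord_point(3)[OF s A] W(7) eq by simp
  moreover have "cell (point ?c B) = ?c"
    using cell(1)[OF point_in_topspace[OF s A]] W(7) v by (intro cell_point_open) auto
  ultimately show ?thesis by simp
qed

lemma closed_cell_point:
  assumes "s \<in> S" "y \<in> closed_cell s"
  shows "\<exists>A\<in>weights (verts s). y = point s A"
proof -
  obtain x where "x \<in> standard_simplex (sdim s)" "y = \<Phi> s x" using assms(2) by blast
  then show ?thesis using simplex_weights(1,2)[OF assms(1)] by metis
qed

lemma coord_closed_cell:
  assumes s: "s \<in> S" and y: "y \<in> closed_cell s"
  shows "coord y \<in> weights (verts s)" "point s (coord y) = y" "verts (cell y) \<subseteq> verts s"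
    and "B \<in> weights (verts (cell y)) \<Longrightarrow> point (cell y) B = point s B"
proof -
  obtain A where A: "A \<in> weights (verts s)" "y = point s A" using closed_cell_point[OF s y] by blast
  show "coord y \<in> weights (verts s)" "point s (coord y) = y" "verts (cell y) \<subseteq> verts s"
    "B \<in> weights (verts (cell y)) \<Longrightarrow> point (cell y) B = point s B"
    using A coord_point[OF s A(1)] weights_supp[OF A(1)] by auto
qed

lemma topspace_closed_cell: "y \<in> topspace Y \<Longrightarrow> y \<in> closed_cell (cell y)"
  using cell[of y] by (auto simp: open_standard_simplex_def)

text \<open>By \<open>cell_point_cong\<close> the carrier depends only on the support of the
  coordinates, which is a subset of the finite set \<open>verts s\<close>.\<close>

lemma finite_cells_closed_cell:
  assumes s: "s \<in> S"
  shows "finite (cell ` closed_cell s)"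
proof -
  define f where "f W = (SOME t. \<exists>A\<in>weights (verts s). supp A = W \<and> t = cell (point s A))" for W
  have "cell y \<in> f ` Pow (verts s)" if y: "y \<in> closed_cell s" for y
  proof -
    obtain A where A: "A \<in> weights (verts s)" "y = point s A" using closed_cell_point[OF s y] by blast
    have "\<exists>B\<in>weights (verts s). supp B = supp A \<and> f (supp A) = cell (point s B)"
      unfolding f_def by (rule someI_ex) (use A in blast)
    then obtain B where "B \<in> weights (verts s)" "supp B = supp A" "f (supp A) = cell (point s B)"
      by blast
    then have "f (supp A) = cell y" using cell_point_cong[OF s, of B A] A by simp
    then show ?thesis using weights_supp[OF A(1)] by (metis PowI finite_verts imageI)
  qed
  then have "cell ` closed_cell s \<subseteq> f ` Pow (verts s)" by blast
  then show ?thesis by (rule finite_subset) simp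
qed

subsection \<open>Affine simplices\<close>

definition aff :: "'c \<Rightarrow> 'b list \<Rightarrow> (nat \<Rightarrow> real) \<Rightarrow> 'b" where
  "aff s w = (\<lambda>x\<in>standard_simplex (length w - 1). point s (word_weights w x))"

lemma aff_eq_pull_vertices:
  assumes s: "s \<in> S" and w: "w \<noteq> []" "set w \<subseteq> verts s"
  shows "aff s w = pull_vertices (length w - 1) (\<lambda>i. vertex_index s (w ! i)) (\<Phi> s)"
proof -
  have "(\<lambda>k. \<Sum>j | j \<le> length w - 1 \<and> vertex_index s (w ! j) = k. x j)
      = (\<lambda>i. if i \<le> sdim s then word_weights w x (vertex s i) else 0)" for x
  proof
    fix k
    have le: "j \<le> length w - Suc 0 \<longleftrightarrow> j < length w" for j using w(1) by (cases w) auto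
    have idx: "vertex_index s (w ! j) = k \<longleftrightarrow> k \<le> sdim s \<and> w ! j = vertex s k" if "j < length w" for j
      using w(2) nth_mem[OF that] vertex_index[OF s] by (metis subsetD)
    have "{j. j \<le> length w - 1 \<and> vertex_index s (w ! j) = k}
        = (if k \<le> sdim s then {j\<in>{..<length w}. w ! j = vertex s k} else {})"
      using idx by (auto simp: le)
    then show "(\<Sum>j | j \<le> length w - 1 \<and> vertex_index s (w ! j) = k. x j)
        = (if k \<le> sdim s then word_weights w x (vertex s k) else 0)"
      using sum.inter_filter[of "{..<length w}" x "\<lambda>j. w ! j = vertex s k"]
      by (simp add: word_weights_def)
  qed
  then show ?thesis
    by (auto simp: aff_def pull_vertices_def simplex_map_def affine_vertex_map_apply point_def restrict_def fun_eq_iff)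
qed

lemma singular_simplex_aff:
  assumes "s \<in> S" "w \<noteq> []" "set w \<subseteq> verts s"
  shows "singular_simplex (length w - 1) Y (aff s w)"
proof -
  have "vertex_index s (w ! j) \<le> sdim s" if "j \<le> length w - 1" for j
    using assms that nth_mem[of j w] vertex_index(2) by (cases w) auto
  then show ?thesis
    unfolding aff_eq_pull_vertices[OF assms]
    by (intro singular_simplex_pull_vertices[OF characteristic_map[OF assms(1)]])
qed

lemma singular_face_aff:
  assumes "s \<in> S" "k < length w" "2 \<le> length w" "set w \<subseteq> verts s"
  shows "singular_face (length w - 1) k (aff s w) = aff s (delete_nth k w)"
proof -
  obtain p where p: "length w = Suc (Suc p)" using assms(3) by (metis Suc_le_D numeral_2_eq_2 Suc_le_mono)
  have l: "length (delete_nth k w) = Suc p" using p assms by (simp add: length_delete_nth)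
  have ne: "w \<noteq> []" "delete_nth k w \<noteq> []" using p l by auto
  have "singular_face (Suc p) k (aff s w) = pull_vertices p (\<lambda>j. vertex_index s (w ! skip k j)) (\<Phi> s)"
    using assms p
    by (subst singular_face_pull_vertices)
      (auto simp: aff_eq_pull_vertices[OF assms(1) ne(1) assms(4)] intro!: pull_vertices_compose)
  also have "\<dots> = aff s (delete_nth k w)"
  proof -
    have "set (delete_nth k w) \<subseteq> verts s" using assms(4) set_delete_nth by fast
    then show ?thesis
      using aff_eq_pull_vertices[OF assms(1) ne(2)] l p assms
      by (auto simp: nth_delete_nth intro!: pull_vertices_cong)
  qed
  finally show ?thesis using p by simp
qed

lemma aff_vertex:
  assumes "s \<in> S" "set w \<subseteq> verts s" "i < length w"
  shows "aff s w (\<lambda>j. if j = i then 1 else 0) = w ! i"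
proof -
  have "(\<lambda>j. if j = i then 1 else 0) \<in> standard_simplex (length w - 1)" using assms(3) by auto
  then show ?thesis
    using assms nth_mem[OF assms(3)] by (simp add: aff_def word_weights_vertex point_vertex subsetD)
qed

lemma aff_face:
  assumes "s \<in> S" "t \<in> S" "\<And>A. A \<in> weights (set w) \<Longrightarrow> point t A = point s A" "w \<noteq> []"
  shows "aff t w = aff s w"
  using assms word_weights_in[of _ w] by (auto simp: aff_def restrict_def fun_eq_iff)

text \<open>Makes data attached to a cell and a word well defined on the singular simplex. The
  vertices of the simplex recover the word. At the barycentre all letters have positive weight, so
  its carrier is the face spanned by the word, in both cells.\<close>

lemma aff_eqD:
  assumes s: "s \<in> S" "s' \<in> S" and w: "w \<noteq> []" "length w = length w'" "set w \<subseteq> verts s" "set w' \<subseteq> verts s'"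
    and eq: "aff s w = aff s' w'"
  shows "w' = w" "\<lbrakk>u \<noteq> []; set u \<subseteq> set w\<rbrakk> \<Longrightarrow> aff s u = aff s' u"
proof -
  show ww: "w' = w"
    using w aff_vertex[OF s(1) w(3)] aff_vertex[OF s(2) w(4)] eq by (intro nth_equalityI) metis+
  define x :: "nat \<Rightarrow> real" where "x = (\<lambda>i. if i < length w then 1 / length w else 0)"
  have "{..length w - 1} = {..<length w}" using w by (cases w) auto
  then have x: "x \<in> standard_simplex (length w - 1)"
    using w by (auto simp: standard_simplex_def x_def divide_le_eq_1 Suc_le_eq)
  let ?A = "word_weights w x"
  have A: "?A \<in> weights (set w)" using word_weights_in[OF x w(1)] .
  have supp: "supp ?A = set w" by (rule supp_word_weights) (auto simp: x_def)
  have As: "?A \<in> weights (verts s)" "?A \<in> weights (verts s')"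
    using A w ww weights_mono[OF _ finite_verts] by blast+
  have "point s ?A = point s' ?A"
    using eq x ww by (auto simp: aff_def restrict_def fun_eq_iff dest!: spec[of _ x])
  then have "point s B = point s' B" if "B \<in> weights (set w)" for B
    using coord_point(3)[OF s(1) As(1)] coord_point(3)[OF s(2) As(2)] that supp by metis
  then show "aff s u = aff s' u" if u: "u \<noteq> []" "set u \<subseteq> set w"
    using aff_face[OF s(2) s(1), of u] u weights_mono[of "set u" "set w"] by blast
qed

end

section \<open>Continuity and compactness in the complex\<close>

abbreviation simplex_topology :: "nat \<Rightarrow> (nat \<Rightarrow> real) topology" where
  "simplex_topology p \<equiv> subtopology (powertop_real UNIV) (standard_simplex p)"

lemma compact_space_simplex_topology: "compact_space (simplex_topology p)"
  by (rule compact_space_subtopology[OF compactin_standard_simplex])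

lemma continuous_map_coordinate:
  "continuous_map (simplex_topology p) euclideanreal (\<lambda>x. x i)"
  by (intro continuous_map_from_subtopology continuous_map_product_projection) simp

lemma connectedin_finite_Hausdorff:
  assumes "Hausdorff_space X" "connectedin X C" "finite C" "a \<in> C"
  shows "C = {a}"
  using connectedin_imp_perfect[OF assms(1,2)] infinite_perfect_set[OF assms(1)] assms(3,4) by blast

context simplicial_cell_complex
begin

lemma closedin_characteristic_image:
  assumes s: "s \<in> S" and C: "closedin (simplex_topology (sdim s)) C"
  shows "closedin Y (\<Phi> s ` C)"
proof -
  have "compactin (simplex_topology (sdim s)) C"
    using closedin_compact_space[OF compact_space_simplex_topology C] .
  then have "compactin Y (\<Phi> s ` C)"
    using characteristic_map[OF s] by (intro image_compactin) (auto simp: singular_simplex_def)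
  then show ?thesis by (rule compactin_imp_closedin[OF Hausdorff])
qed

lemma closedin_closed_cell: "s \<in> S \<Longrightarrow> closedin Y (closed_cell s)"
  using closedin_characteristic_image[of s "topspace (simplex_topology (sdim s))"] by simp

text \<open>The weak topology reduces this to closed cells, where \<open>coord\<close> is a
  coordinate of the standard simplex and images of closed sets are compact, hence closed.\<close>

lemma continuous_map_coord: "continuous_map Y euclideanreal (\<lambda>y. coord y v)"
  unfolding continuous_map_closedin
proof (intro conjI allI impI)
  fix K :: "real set" assume K: "closedin euclideanreal K"
  let ?C = "{y \<in> topspace Y. coord y v \<in> K}"
  show "closedin Y ?C"
  proof (rule weak_topology)
    fix s assume s: "s \<in> S"
    let ?D = "{x \<in> topspace (simplex_topology (sdim s)). simplex_weights s x v \<in> K}"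
    have "continuous_map (simplex_topology (sdim s)) euclideanreal (\<lambda>x. simplex_weights s x v)"
      unfolding simplex_weights_def by (cases "v \<in> verts s") (auto simp: continuous_map_coordinate)
    then have "closedin (simplex_topology (sdim s)) ?D"
      using K by (rule closedin_continuous_map_preimage)
    then have "closedin Y (\<Phi> s ` ?D)" by (rule closedin_characteristic_image[OF s])
    moreover have "coord (\<Phi> s x) = simplex_weights s x" if "x \<in> standard_simplex (sdim s)" for x
      using simplex_weights[OF s that] coord_point(1)[OF s] by metis
    then have "?C \<inter> closed_cell s = \<Phi> s ` ?D"
      using closed_cell_subset[OF s] by auto
    ultimately show "closedin Y (?C \<inter> closed_cell s)" by simp
  qed auto
qed auto

text \<open>Pick one point of \<open>K\<close> in each open cell that \<open>K\<close> meets. Every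
  subset of the resulting set \<open>Q\<close> meets each closed cell in a finite set and is
  therefore closed; so \<open>Q\<close> is compact and discrete, hence finite.\<close>

lemma finite_cells_compact:
  assumes K: "compactin Y K"
  shows "finite (cell ` K)"
proof -
  have KY: "K \<subseteq> topspace Y" using K by (rule compactin_subset_topspace)
  define q where "q = inv_into K cell"
  define Q where "Q = q ` cell ` K"
  have q: "q s \<in> K" "cell (q s) = s" if "s \<in> cell ` K" for s
    using inv_into_into[OF that] f_inv_into_f[OF that] by (auto simp: q_def)
  then have QK: "Q \<subseteq> K" by (auto simp: Q_def)
  have inj: "inj_on cell Q" using q by (auto simp: inj_on_def Q_def)
  have closed: "closedin Y R" if R: "R \<subseteq> Q" for R
  proof (rule weak_topology)
    show "R \<subseteq> topspace Y" using R QK KY by blast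
    fix s assume s: "s \<in> S"
    have "finite (cell ` (R \<inter> closed_cell s))"
      by (rule finite_subset[OF _ finite_cells_closed_cell[OF s]]) auto
    then have "finite (R \<inter> closed_cell s)"
      by (rule finite_imageD) (use inj_on_subset[OF inj, of "R \<inter> closed_cell s"] R in blast)
    then show "closedin Y (R \<inter> closed_cell s)"
      using closed_cell_subset[OF s] by (intro closedin_Hausdorff_finite[OF Hausdorff]) auto
  qed
  have Q: "compactin Y Q" by (rule closed_compactin[OF K QK closed]) simp
  \<comment> \<open>\<open>?U x\<close> meets \<open>Q\<close> in \<open>x\<close> alone, so a
    finite subcover bounds \<open>Q\<close>.\<close>
  let ?U = "\<lambda>x. topspace Y - (Q - {x})"
  have "\<exists>\<F>. finite \<F> \<and> \<F> \<subseteq> ?U ` Q \<and> Q \<subseteq> \<Union>\<F>"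
    using QK KY closed by (intro compactinD[OF Q]) (auto intro!: openin_diff)
  then obtain \<F> where \<F>: "finite \<F>" "\<F> \<subseteq> ?U ` Q" "Q \<subseteq> \<Union>\<F>" by blast
  obtain R where R: "R \<subseteq> Q" "finite R" "\<F> = ?U ` R" using finite_subset_image[OF \<F>(1,2)] by blast
  have "Q \<subseteq> R" using \<F>(3) R(1) unfolding R(3) by blast
  then have "finite Q" using R(2) finite_subset by blast
  moreover have "cell ` K \<subseteq> cell ` Q"
  proof
    fix s assume "s \<in> cell ` K"
    then show "s \<in> cell ` Q" using q(2)[of s] unfolding Q_def by (metis imageI)
  qed
  ultimately show ?thesis using finite_subset by blast
qed

text \<open>Each \<open>h x\<close> is moved within its own carrier, which may jump as
  \<open>x\<close> varies. Continuity comes from pasting over finitely many closed cells: on the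
  preimage of the closed cell \<open>t\<close> the map can be computed in \<open>t\<close>.\<close>

lemma continuous_map_point:
  assumes K: "compact_space K" and h: "continuous_map K Y h"
    and A: "\<And>v. continuous_map K euclideanreal (\<lambda>x. A x v)"
    and W: "\<And>x. x \<in> topspace K \<Longrightarrow> A x \<in> weights (verts (cell (h x)))"
  shows "continuous_map K Y (\<lambda>x. point (cell (h x)) (A x))"
proof -
  let ?I = "cell ` h ` topspace K"
  let ?T = "\<lambda>t. {x \<in> topspace K. h x \<in> closed_cell t}"
  have hY: "h x \<in> topspace Y" if "x \<in> topspace K" for x
    using h that by (auto simp: continuous_map_def)
  have IS: "t \<in> S" if "t \<in> ?I" for t using that cell(1) hY by auto
  have At: "A x \<in> weights (verts t)" if "t \<in> ?I" "x \<in> ?T t" for t x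
    using that W[of x] weights_mono[OF coord_closed_cell(3)[OF IS[OF that(1)]]] by fastforce
  have pt: "point (cell (h x)) (A x) = point t (A x)" if "t \<in> ?I" "x \<in> ?T t" for t x
    using that W[of x] coord_closed_cell(4)[OF IS[OF that(1)]] by auto
  show ?thesis
  proof (rule pasting_lemma_closed[where I = ?I and T = ?T and f = "\<lambda>t x. point t (A x)"])
    show "finite ?I"
      using image_compactin[OF _ h, of "topspace K"] K
      by (intro finite_cells_compact) (auto simp: compact_space_def)
  next
    fix t assume t: "t \<in> ?I"
    show "closedin K (?T t)"
      by (rule closedin_continuous_map_preimage[OF h closedin_closed_cell[OF IS[OF t]]])
    let ?g = "\<lambda>x i. if i \<le> sdim t then A x (vertex t i) else 0"
    have "continuous_map (subtopology K (?T t)) (simplex_topology (sdim t)) ?g"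
      unfolding continuous_map_in_subtopology continuous_map_componentwise_UNIV
    proof (intro conjI allI)
      fix i show "continuous_map (subtopology K (?T t)) euclideanreal (\<lambda>x. ?g x i)"
        by (cases "i \<le> sdim t") (auto intro: continuous_map_from_subtopology A)
    qed (use weights_imp_simplex[OF IS[OF t] At[OF t]] in auto)
    then have "continuous_map (subtopology K (?T t)) Y (\<Phi> t \<circ> ?g)"
      using characteristic_map[OF IS[OF t]]
      by (intro continuous_map_compose) (auto simp: singular_simplex_def)
    then show "continuous_map (subtopology K (?T t)) Y (\<lambda>x. point t (A x))"
      by (simp add: o_def point_def)
  next
    fix i j x assume "i \<in> ?I" "j \<in> ?I" "x \<in> topspace K \<inter> ?T i \<inter> ?T j"
    then show "point i (A x) = point j (A x)"
      using pt[of i x] pt[of j x] by simp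
  next
    fix x assume "x \<in> topspace K"
    then show "\<exists>t. t \<in> ?I \<and> x \<in> ?T t \<and> point (cell (h x)) (A x) = point t (A x)"
      using topspace_closed_cell hY by (intro exI[of _ "cell (h x)"]) auto
  qed
qed

subsection \<open>Small simplices\<close>

definition label :: "'b \<Rightarrow> 'b" where
  "label y = (SOME v. \<forall>u. coord y u \<le> coord y v)"

text \<open>With \<open>m\<close> vertices in the carrier of \<open>y0\<close> and tolerance
  \<open>e = 1/(4 m^2)\<close>, the coordinates there lose at most \<open>m e = 1/(4m)\<close> in
  total. So the largest coordinate of \<open>y\<close> is at least \<open>3/(4m)\<close>, while the
  weight off these vertices is at most \<open>1/(4m)\<close>; hence the label is one of them, and a
  deviation of \<open>2e\<close> keeps its coordinate positive. Constraining finitely many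
  coordinates keeps the set open.\<close>

definition nbhd :: "'b \<Rightarrow> 'b set" where
  "nbhd y0 = {y \<in> topspace Y. \<forall>v\<in>verts (cell y0).
     \<bar>coord y v - coord y0 v\<bar> < 1 / (4 * real (card (verts (cell y0))) ^ 2)}"

lemma label:
  assumes y: "y \<in> topspace Y"
  shows "coord y u \<le> coord y (label y)"
proof -
  let ?V = "verts (cell y)"
  have "Max (coord y ` ?V) \<in> coord y ` ?V" by (intro Max_in) auto
  then obtain v where v: "v \<in> ?V" "coord y v = Max (coord y ` ?V)" by (metis imageE)
  have "coord y u \<le> coord y v" for u
  proof (cases "u \<in> ?V")
    case False
    then show ?thesis using coord(1)[OF y] by (auto simp: weights_def)
  qed (use v in auto)
  then have "\<exists>v. \<forall>u. coord y u \<le> coord y v" by blast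
  then have "\<forall>u. coord y u \<le> coord y (label y)" unfolding label_def by (rule someI_ex)
  then show ?thesis by blast
qed

lemma openin_nbhd: "openin Y (nbhd y0)"
proof -
  let ?V = "verts (cell y0)" and ?e = "1 / (4 * real (card (verts (cell y0))) ^ 2)"
  have eq: "(\<Inter>v\<in>V. {y \<in> T. P v y}) = {y \<in> T. \<forall>v\<in>V. P v y}"
    if "V \<noteq> {}" for V T :: "'b set" and P
    using that by auto
  have abs: "\<bar>r\<bar> < ?e \<longleftrightarrow> r \<in> {- ?e<..<?e}" for r by auto
  have "openin Y {y \<in> topspace Y. coord y v - coord y0 v \<in> {- ?e<..<?e}}" for v
    by (rule openin_continuous_map_preimage[where Y = euclideanreal])
      (intro continuous_map_diff continuous_map_coord, auto)
  then have "openin Y (\<Inter>v\<in>?V. {y \<in> topspace Y. coord y v - coord y0 v \<in> {- ?e<..<?e}})"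
    by (intro openin_INT2) auto
  also have "(\<Inter>v\<in>?V. {y \<in> topspace Y. coord y v - coord y0 v \<in> {- ?e<..<?e}}) = nbhd y0"
    unfolding nbhd_def abs by (rule eq[OF verts_nonempty])
  finally show ?thesis .
qed

lemma mem_nbhd: "y \<in> topspace Y \<Longrightarrow> y \<in> nbhd y"
  by (simp add: nbhd_def card_gt_0_iff)

lemma label_pos:
  assumes y: "y \<in> nbhd y0" and y': "y' \<in> nbhd y0" and y0: "y0 \<in> topspace Y"
  shows "0 < coord y' (label y)"
proof -
  let ?V = "verts (cell y0)"
  define m where "m = real (card ?V)"
  have m: "1 \<le> m" by (simp add: m_def Suc_le_eq card_gt_0_iff)
  define e where "e = 1 / (4 * m ^ 2)"
  have e: "0 < e" "m * e = 1 / (4 * m)" "e \<le> 1 / (4 * m)"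
    using m by (auto simp: e_def power2_eq_square field_simps)
  have yY: "y \<in> topspace Y" using y by (simp add: nbhd_def)
  have near: "\<bar>coord x v - coord y0 v\<bar> < e" if "x \<in> nbhd y0" "v \<in> ?V" for x v
    using that by (auto simp: nbhd_def e_def m_def)
  have sum0: "sum (coord y0) ?V = 1" using coord(1)[OF y0] by (simp add: weights_def)
  have "sum (coord y) ?V \<ge> (\<Sum>v\<in>?V. coord y0 v - e)"
    using near[OF y] by (intro sum_mono) (smt (verit, best))
  then have sumV: "sum (coord y) ?V \<ge> 1 - 1 / (4 * m)"
    by (simp add: sum_subtractf sum0 flip: e(2) m_def)
  have "sum (coord y) ?V \<le> (\<Sum>v\<in>?V. coord y (label y))"
    using label[OF yY] by (intro sum_mono)
  then have "1 - 1 / (4 * m) \<le> m * coord y (label y)"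
    using sumV by (simp add: m_def)
  moreover have "1 / (4 * m) \<le> 1 / 4" using m by (simp add: field_simps)
  ultimately have "3 / 4 \<le> m * coord y (label y)" by linarith
  then have max: "3 / (4 * m) \<le> coord y (label y)" using m by (simp add: field_simps)
  have "label y \<in> ?V"
  proof (rule ccontr)
    assume l: "label y \<notin> ?V"
    let ?U = "insert (label y) ?V \<union> verts (cell y)"
    have "sum (coord y) (insert (label y) ?V) \<le> sum (coord y) ?U"
      using coord(1)[OF yY] by (intro sum_mono2) (auto simp: weights_def)
    also have "\<dots> = sum (coord y) (verts (cell y))"
      using coord(1)[OF yY] by (intro sum.mono_neutral_right) (auto simp: weights_def)
    also have "\<dots> = 1" using coord(1)[OF yY] by (simp add: weights_def)
    finally have "coord y (label y) \<le> 1 / (4 * m)" using l sumV by simp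
    moreover have "1 / (4 * m) < 3 / (4 * m)" using m by (simp add: field_simps)
    ultimately show False using max by linarith
  qed
  then have "\<bar>coord y (label y) - coord y0 (label y)\<bar> < e" "\<bar>coord y' (label y) - coord y0 (label y)\<bar> < e"
    using near y y' by blast+
  then have "coord y' (label y) > 3 / (4 * m) - 2 * (1 / (4 * m))" using max e(3) by linarith
  moreover have "3 / (4 * m) - 2 * (1 / (4 * m)) = 1 / (4 * m)" using m by (simp add: field_simps)
  moreover have "0 < 1 / (4 * m)" using m by simp
  ultimately show ?thesis by linarith
qed

text \<open>Every label of a point of \<open>g\<close> is a vertex of the carrier of every point of
  \<open>g\<close>. This suffices for the straight line homotopy, although \<open>g\<close> need not
  lie in a single closed cell.\<close>

definition small :: "nat \<Rightarrow> ((nat \<Rightarrow> real) \<Rightarrow> 'b) \<Rightarrow> bool" where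
  "small p g \<longleftrightarrow> singular_simplex p Y g \<and>
    (\<forall>x\<in>standard_simplex p. \<forall>x'\<in>standard_simplex p. 0 < coord (g x') (label (g x)))"

lemma small_if_in_nbhd:
  assumes "singular_simplex p Y g" "g ` standard_simplex p \<subseteq> nbhd y0" "y0 \<in> topspace Y"
  shows "small p g"
  using assms label_pos[OF _ _ assms(3)] unfolding small_def by blast

lemma singular_simplex_in_topspace:
  "\<lbrakk>singular_simplex p Y g; x \<in> standard_simplex p\<rbrakk> \<Longrightarrow> g x \<in> topspace Y"
  by (auto simp: singular_simplex_def continuous_map_def)

text \<open>The faces spanned by a fixed vertex set \<open>W\<close> in the cells met by a connected set agree,
  since their barycentres form a connected set which is also finite.\<close>

lemma common_face:
  assumes g: "singular_simplex p Y g" and W: "finite W" "W \<noteq> {}"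
    and Wg: "\<And>x. x \<in> standard_simplex p \<Longrightarrow> W \<subseteq> verts (cell (g x))"
  shows "\<exists>s\<in>S. verts s = W \<and> (\<forall>x\<in>standard_simplex p. \<forall>A\<in>weights W. point (cell (g x)) A = point s A)"
proof -
  \<comment> \<open>The barycentre of \<open>W\<close>: its support is all of \<open>W\<close>, so
    the carrier of \<open>?f x\<close> is the face of \<open>cell (g x)\<close> spanned by
    \<open>W\<close>.\<close>
  define B where "B v = (if v \<in> W then 1 / real (card W) else 0)" for v
  have B: "B \<in> weights W" "supp B = W"
    using W by (auto simp: weights_def supp_def B_def)
  have gY: "g x \<in> topspace Y" if "x \<in> standard_simplex p" for x
    by (rule singular_simplex_in_topspace[OF g that])
  have Bg: "B \<in> weights (verts (cell (g x)))" if "x \<in> standard_simplex p" for x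
    using B Wg[OF that] weights_mono[OF _ finite_verts] by blast
  let ?f = "\<lambda>x. point (cell (g x)) B" and ?D = "standard_simplex p"
  have gc: "continuous_map (simplex_topology p) Y g" using g by (simp add: singular_simplex_def)
  have "continuous_map (simplex_topology p) Y ?f"
    using Bg by (intro continuous_map_point[OF compact_space_simplex_topology gc]) auto
  moreover have "connectedin (simplex_topology p) ?D"
    using connectedin_standard_simplex[of p] by (simp add: connectedin_subtopology)
  ultimately have conn: "connectedin Y (?f ` ?D)" by (rule connectedin_continuous_map_image)
  \<comment> \<open>\<open>?f x\<close> depends only on the carrier of \<open>g x\<close>, and a
    compact image has finitely many carriers.\<close>
  have "compactin Y (g ` ?D)"
    using image_compactin[OF _ gc] compact_space_simplex_topology[of p]
    by (metis compact_space_def topspace_standard_simplex)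
  then have "finite (cell ` g ` ?D)" by (rule finite_cells_compact)
  then have "finite ((\<lambda>t. point t B) ` cell ` g ` ?D)" by simp
  then have fin: "finite (?f ` ?D)" by (simp add: image_image)
  obtain x0 where x0: "x0 \<in> ?D" using nonempty_standard_simplex by blast
  have const: "?f x = ?f x0" if "x \<in> ?D" for x
    using connectedin_finite_Hausdorff[OF Hausdorff conn fin, of "?f x0"] x0 that by blast
  define s where "s = cell (?f x0)"
  have cx0: "cell (g x0) \<in> S" by (rule cell(1)[OF gY[OF x0]])
  have "s \<in> S" unfolding s_def by (intro cell(1) point_in_topspace cx0 Bg x0)
  moreover have "verts s = W"
    unfolding s_def using coord_point(2)[OF cx0 Bg[OF x0]] B(2) by simp
  moreover have "point (cell (g x)) A = point s A" if x: "x \<in> ?D" and A: "A \<in> weights W" for x A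
    using coord_point(3)[OF cell(1)[OF gY[OF x]] Bg[OF x], of A] A B(2) const[OF x] by (simp add: s_def)
  ultimately show ?thesis by blast
qed

end

section \<open>The prism operator of the straight line homotopy\<close>

lemma affine_vertex_map_ident:
  assumes x: "x \<in> standard_simplex p"
  shows "affine_vertex_map p (\<lambda>i. i) x = x"
proof
  fix i
  have "x i = 0" if "\<not> i \<le> p" using that x by (auto simp: standard_simplex_def)
  moreover have "{j. j \<le> p \<and> j = i} = (if i \<le> p then {i} else {})" by auto
  ultimately show "affine_vertex_map p (\<lambda>i. i) x i = x i"
    by (auto simp: affine_vertex_map_apply[OF x])
qed

lemma sum_affine_vertex_map:
  assumes u: "u \<in> standard_simplex q" and v: "\<And>j. j \<le> q \<Longrightarrow> v j \<le> r"
  shows "(\<Sum>j\<le>r. if P j then affine_vertex_map q v u j else 0) = (\<Sum>i\<le>q. if P (v i) then u i else 0)"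
proof -
  have "(\<Sum>j\<le>r. if P j then affine_vertex_map q v u j else 0)
      = (\<Sum>j\<le>r. \<Sum>i | i \<in> {..q} \<and> v i = j. if P (v i) then u i else 0)"
    by (rule sum.cong) (auto simp: affine_vertex_map_apply[OF u] intro!: sum.cong)
  also have "\<dots> = (\<Sum>i\<le>q. if P (v i) then u i else 0)"
    by (rule sum.group) (use v in auto)
  finally show ?thesis .
qed

lemma continuous_map_affine_vertex_map:
  assumes "\<And>j. j \<le> p \<Longrightarrow> v j \<le> q"
  shows "continuous_map (simplex_topology p) (simplex_topology q) (affine_vertex_map p v)"
  unfolding continuous_map_in_subtopology continuous_map_componentwise_UNIV
proof (intro conjI allI)
  fix k
  have "continuous_map (simplex_topology p) euclideanreal (\<lambda>x. \<Sum>j | j \<le> p \<and> v j = k. x j)"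
    by (intro continuous_map_sum continuous_map_coordinate) auto
  then show "continuous_map (simplex_topology p) euclideanreal (\<lambda>x. affine_vertex_map p v x k)"
    by (rule continuous_map_eq) (simp add: affine_vertex_map_apply)
qed (use affine_vertex_map_in assms in auto)

text \<open>The index bookkeeping of the prism operator: \<open>D i k\<close> is the value of a cocycle on the
  \<open>k\<close>-th face of the \<open>i\<close>-th simplex of the prism.\<close>

lemma prism_sum:
  fixes D R :: "nat \<Rightarrow> nat \<Rightarrow> bit"
  assumes zero: "\<And>i. i \<le> p \<Longrightarrow> (\<Sum>k\<le>Suc p. D i k) = 0"
    and diag: "\<And>i. i \<le> p \<Longrightarrow> D i i = q i" "\<And>i. i \<le> p \<Longrightarrow> D i (Suc i) = q (Suc i)"
    and lower: "\<And>i k. \<lbrakk>i < p; k \<le> i\<rbrakk> \<Longrightarrow> D (Suc i) k = R i k"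
    and upper: "\<And>i k. \<lbrakk>i < k; k \<le> p\<rbrakk> \<Longrightarrow> D i (Suc k) = R i k"
  shows "q 0 + q (Suc p) = (\<Sum>k\<le>p. \<Sum>i<p. R i k)"
proof -
  \<comment> \<open>The boundary of the \<open>i\<close>-th simplex: its faces \<open>i\<close> and
    \<open>Suc i\<close> are shared with the neighbouring simplices, or are an end of the prism; the
    others lie on the side walls.\<close>
  have row: "(\<Sum>k<i. D i k) + (q i + q (Suc i)) + (\<Sum>k\<in>{i<..p}. R i k) = 0" if i: "i \<le> p" for i
  proof -
    have "{..Suc p} = {..<i} \<union> {i, Suc i} \<union> Suc ` {i<..p}"
    proof -
      have "x \<in> Suc ` {i<..p} \<longleftrightarrow> Suc i < x \<and> x \<le> Suc p" for x by (cases x) auto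
      then show ?thesis using i by auto
    qed
    then have "(\<Sum>k\<le>Suc p. D i k) = sum (D i) ({..<i} \<union> {i, Suc i} \<union> Suc ` {i<..p})" by simp
    also have "\<dots> = sum (D i) {..<i} + sum (D i) {i, Suc i} + sum (D i) (Suc ` {i<..p})"
      by (subst sum.union_disjoint; (subst sum.union_disjoint)?) auto
    also have "sum (D i) (Suc ` {i<..p}) = (\<Sum>k\<in>{i<..p}. R i k)"
      by (subst sum.reindex) (auto simp: upper intro!: sum.cong)
    finally show ?thesis using i by (simp add: zero diag del: sum.atMost_Suc)
  qed
  have solve: "t = x + y" if "x + t + y = 0" for x y t :: bit
    using that by (cases x; cases y; cases t; simp)
  \<comment> \<open>Each face between consecutive simplices occurs twice, so only the two ends
    remain.\<close>
  have tele: "(\<Sum>i\<le>m. q i + q (Suc i)) = q 0 + q (Suc m)" for m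
    by (induction m) (simp_all add: bit_add_self add_ac)
  \<comment> \<open>\<open>lower\<close> compares row \<open>Suc i\<close> with \<open>R i\<close>,
    which shifts the index by one; row 0 has nothing below the diagonal, just as row
    \<open>p\<close> has nothing above it.\<close>
  have "(\<Sum>i\<le>p. \<Sum>k<i. D i k) = (\<Sum>i<p. \<Sum>k\<le>i. R i k)"
  proof (cases p)
    case (Suc m)
    have "(\<Sum>i\<le>p. \<Sum>k<i. D i k) = (\<Sum>i\<le>m. \<Sum>k<Suc i. D (Suc i) k)"
      unfolding Suc by (subst sum.atMost_Suc_shift) simp
    also have "\<dots> = (\<Sum>i<p. \<Sum>k\<le>i. R i k)"
      unfolding Suc lessThan_Suc_atMost by (intro sum.cong refl) (simp add: lower Suc)
    finally show ?thesis .
  qed simp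
  moreover have "(\<Sum>i\<le>p. \<Sum>k\<in>{i<..p}. R i k) = (\<Sum>i<p. \<Sum>k\<in>{i<..p}. R i k)"
    by (simp add: lessThan_Suc_atMost[symmetric])
  moreover have "(\<Sum>i\<le>p. ((\<Sum>k<i. D i k) + (q i + q (Suc i)) + (\<Sum>k\<in>{i<..p}. R i k))) = 0"
    using row by (intro sum.neutral) auto
  ultimately have "(\<Sum>i<p. \<Sum>k\<le>i. R i k) + (q 0 + q (Suc p)) + (\<Sum>i<p. \<Sum>k\<in>{i<..p}. R i k) = 0"
    by (simp add: sum.distrib tele[unfolded sum.distrib])
  then have "q 0 + q (Suc p) = (\<Sum>i<p. (\<Sum>k\<le>i. R i k) + (\<Sum>k\<in>{i<..p}. R i k))"
    unfolding sum.distrib by (rule solve)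
  also have "\<dots> = (\<Sum>i<p. \<Sum>k\<le>p. R i k)"
  proof (rule sum.cong[OF refl])
    fix i assume "i \<in> {..<p}"
    then have eq: "{..p} = {..i} \<union> {i<..p}" by auto
    show "(\<Sum>k\<le>i. R i k) + (\<Sum>k\<in>{i<..p}. R i k) = (\<Sum>k\<le>p. R i k)"
      unfolding eq by (rule sum.union_disjoint[symmetric]) auto
  qed
  also have "\<dots> = (\<Sum>k\<le>p. \<Sum>i<p. R i k)" by (rule sum.swap)
  finally show ?thesis .
qed

context simplicial_cell_complex
begin

definition labels :: "nat \<Rightarrow> ((nat \<Rightarrow> real) \<Rightarrow> 'b) \<Rightarrow> 'b list" where
  "labels p g = map (\<lambda>i. label (g (\<lambda>j. if j = i then 1 else 0))) [0..<Suc p]"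

definition blend :: "nat \<Rightarrow> ((nat \<Rightarrow> real) \<Rightarrow> 'b) \<Rightarrow> (nat \<Rightarrow> real) \<Rightarrow> real \<Rightarrow> 'b \<Rightarrow> real" where
  "blend p g x t v = (1 - t) * coord (g x) v + t * word_weights (labels p g) x v"

text \<open>The straight line homotopy moves a small simplex \<open>g\<close> to the affine simplex on its labels.
  In \<open>prism_simplex p g q v b\<close>, the \<open>j\<close>-th vertex is sent to the \<open>v j\<close>-th vertex at time \<open>b j\<close>.\<close>

definition prism_simplex ::
    "nat \<Rightarrow> ((nat \<Rightarrow> real) \<Rightarrow> 'b) \<Rightarrow> nat \<Rightarrow> (nat \<Rightarrow> nat) \<Rightarrow> (nat \<Rightarrow> bool) \<Rightarrow> (nat \<Rightarrow> real) \<Rightarrow> 'b" where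
  "prism_simplex p g q v b = (\<lambda>u\<in>standard_simplex q.
     let x = affine_vertex_map q v u
     in point (cell (g x)) (blend p g x (\<Sum>j\<le>q. if b j then u j else 0)))"

lemma length_labels [simp]: "length (labels p g) = Suc p"
  by (simp add: labels_def)

lemma labels_nonempty [simp]: "labels p g \<noteq> []"
  by (simp add: labels_def)

lemma word_weights_labels:
  "word_weights (labels p g) x v
    = (\<Sum>i\<le>p. if label (g (\<lambda>j. if j = i then 1 else 0)) = v then x i else 0)"
  unfolding word_weights_def length_labels lessThan_Suc_atMost
  by (intro sum.cong refl) (simp add: labels_def del: upt_Suc)

lemma set_labels_subset:
  assumes "small p g" "x \<in> standard_simplex p"
  shows "set (labels p g) \<subseteq> verts (cell (g x))"
proof
  fix v assume "v \<in> set (labels p g)"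
  then obtain i where i: "i \<le> p" "v = label (g (\<lambda>j. if j = i then 1 else 0))"
    by (auto simp: labels_def less_Suc_eq_le simp del: upt_Suc)
  have "(\<lambda>j. if j = i then 1 else (0::real)) \<in> standard_simplex p" using i by simp
  then have "0 < coord (g x) v" using assms i unfolding small_def by blast
  moreover have "coord (g x) \<in> weights (verts (cell (g x)))"
    using assms by (intro coord(1) singular_simplex_in_topspace[of p]) (auto simp: small_def)
  ultimately show "v \<in> verts (cell (g x))" by (auto simp: weights_def)
qed

lemma blend_weights:
  assumes g: "small p g" and x: "x \<in> standard_simplex p" and t: "0 \<le> t" "t \<le> 1"
  shows "blend p g x t \<in> weights (verts (cell (g x)))"
proof -
  have "coord (g x) \<in> weights (verts (cell (g x)))"
    using g x by (intro coord(1) singular_simplex_in_topspace[of p]) (auto simp: small_def)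
  moreover have "word_weights (labels p g) x \<in> weights (verts (cell (g x)))"
    using word_weights_in[of x "labels p g"] x weights_mono[OF set_labels_subset[OF g x]] by auto
  ultimately show ?thesis unfolding blend_def using t by (rule weights_convex)
qed

lemma time_in_01:
  assumes "u \<in> standard_simplex q"
  shows "0 \<le> (\<Sum>j\<le>q. if b j then u j else (0::real))" "(\<Sum>j\<le>q. if b j then u j else (0::real)) \<le> 1"
proof -
  have "(\<Sum>j\<le>q. if b j then u j else 0) \<le> (\<Sum>j\<le>q. u j)"
    using assms by (intro sum_mono) (auto simp: standard_simplex_def)
  then show "(\<Sum>j\<le>q. if b j then u j else (0::real)) \<le> 1"
    using assms by (auto simp: standard_simplex_def)
  show "0 \<le> (\<Sum>j\<le>q. if b j then u j else (0::real))"
    using assms by (intro sum_nonneg) (auto simp: standard_simplex_def)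
qed

lemma singular_simplex_prism:
  assumes g: "small p g" and v: "\<And>j. j \<le> q \<Longrightarrow> v j \<le> p"
  shows "singular_simplex q Y (prism_simplex p g q v b)"
proof -
  let ?h = "g \<circ> affine_vertex_map q v" and ?t = "\<lambda>u. \<Sum>j\<le>q. if b j then u j else 0"
  let ?A = "\<lambda>u. blend p g (affine_vertex_map q v u) (?t u)"
  have g': "continuous_map (simplex_topology p) Y g"
    using g by (simp add: small_def singular_simplex_def)
  note aff = continuous_map_affine_vertex_map[OF v]
  have h: "continuous_map (simplex_topology q) Y ?h"
    by (rule continuous_map_compose[OF aff g'])
  have t: "continuous_map (simplex_topology q) euclideanreal ?t"
  proof (rule continuous_map_sum)
    fix j show "continuous_map (simplex_topology q) euclideanreal (\<lambda>u. if b j then u j else 0)"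
      by (cases "b j") (simp_all add: continuous_map_coordinate)
  qed simp
  have c: "continuous_map (simplex_topology q) euclideanreal (\<lambda>u. coord (?h u) w)" for w
    using continuous_map_compose[OF h continuous_map_coord] by (simp add: o_def)
  have aff': "continuous_map (simplex_topology q) euclideanreal (\<lambda>u. affine_vertex_map q v u i)" for i
    using continuous_map_compose[OF aff continuous_map_coordinate] by (simp add: o_def)
  have l: "continuous_map (simplex_topology q) euclideanreal
      (\<lambda>u. word_weights (labels p g) (affine_vertex_map q v u) w)" for w
    unfolding word_weights_def
  proof (rule continuous_map_sum)
    fix i show "continuous_map (simplex_topology q) euclideanreal
        (\<lambda>u. if labels p g ! i = w then affine_vertex_map q v u i else 0)"
      by (cases "labels p g ! i = w") (simp_all add: aff')
  qed simp
  have A: "continuous_map (simplex_topology q) euclideanreal (\<lambda>u. ?A u w)" for w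
    unfolding blend_def
    by (intro continuous_map_add continuous_map_real_mult continuous_map_diff t l c[unfolded o_def]) simp
  have "continuous_map (simplex_topology q) Y (\<lambda>u. point (cell (?h u)) (?A u))"
  proof (rule continuous_map_point[OF compact_space_simplex_topology h A])
    fix u assume "u \<in> topspace (simplex_topology q)"
    then have u: "u \<in> standard_simplex q" by simp
    show "?A u \<in> weights (verts (cell (?h u)))"
      using blend_weights[OF g affine_vertex_map_in[OF u v] time_in_01[OF u]] by simp
  qed
  then have "continuous_map (simplex_topology q) Y (prism_simplex p g q v b)"
    by (rule continuous_map_eq) (simp add: prism_simplex_def Let_def)
  then show ?thesis by (simp add: singular_simplex_def prism_simplex_def Let_def)
qed

lemma prism_simplex_cong:
  assumes "\<And>j. j \<le> q \<Longrightarrow> v j = v' j" "\<And>j. j \<le> q \<Longrightarrow> b j = b' j"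
  shows "prism_simplex p g q v b = prism_simplex p g q v' b'"
proof -
  have "affine_vertex_map q v = affine_vertex_map q v'" using assms(1) by (rule affine_vertex_map_cong)
  moreover have "(\<Sum>j\<le>q. if b j then u j else 0) = (\<Sum>j\<le>q. if b' j then u j else 0)" for u :: "nat \<Rightarrow> real"
    using assms(2) by (intro sum.cong) auto
  ultimately show ?thesis by (simp add: prism_simplex_def Let_def)
qed

lemma singular_face_prism:
  assumes "k \<le> Suc q"
  shows "singular_face (Suc q) k (prism_simplex p g (Suc q) v b)
    = prism_simplex p g q (\<lambda>j. v (skip k j)) (\<lambda>j. b (skip k j))"
proof -
  have le: "skip k j \<le> Suc q" if "j \<le> q" for j using that by auto
  show ?thesis
    unfolding singular_face_pull_vertices[OF assms]
  proof
    fix u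
    show "pull_vertices q (skip k) (prism_simplex p g (Suc q) v b) u
        = prism_simplex p g q (\<lambda>j. v (skip k j)) (\<lambda>j. b (skip k j)) u"
    proof (cases "u \<in> standard_simplex q")
      case True
      then show ?thesis
        using affine_vertex_map_in[where v = "skip k", OF True le]
          affine_vertex_map_compose[where v = "skip k" and w = v, OF True le]
          sum_affine_vertex_map[where v = "skip k" and P = b, OF True le]
        by (simp add: pull_vertices_def simplex_map_def prism_simplex_def Let_def del: sum.atMost_Suc)
    qed (simp add: pull_vertices_def simplex_map_def prism_simplex_def Let_def)
  qed
qed

text \<open>Naturality of the homotopy: the labels of a face of \<open>g\<close> are those of
  \<open>g\<close> at the remaining vertices. It identifies the side walls of the prism with prisms
  over the faces.\<close>

lemma prism_simplex_face:
  assumes k: "k \<le> Suc p" and v: "\<And>j. j \<le> q \<Longrightarrow> v j \<le> p"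
  shows "prism_simplex p (singular_face (Suc p) k g) q v b
    = prism_simplex (Suc p) g q (\<lambda>j. skip k (v j)) b"
proof
  fix u
  show "prism_simplex p (singular_face (Suc p) k g) q v b u
      = prism_simplex (Suc p) g q (\<lambda>j. skip k (v j)) b u"
  proof (cases "u \<in> standard_simplex q")
    case True
    let ?x = "affine_vertex_map q v u"
    have le: "skip k j \<le> Suc p" if "j \<le> p" for j using that by auto
    have x: "?x \<in> standard_simplex p" by (rule affine_vertex_map_in[OF True v])
    have face: "singular_face (Suc p) k g y = g (affine_vertex_map p (skip k) y)" if "y \<in> standard_simplex p" for y
      using that by (simp add: singular_face_pull_vertices[OF k] pull_vertices_def simplex_map_def)
    have comp: "affine_vertex_map p (skip k) ?x = affine_vertex_map q (\<lambda>j. skip k (v j)) u"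
      by (rule affine_vertex_map_compose[OF True v])
    have lab: "label (singular_face (Suc p) k g (\<lambda>j. if j = i then 1 else 0))
        = label (g (\<lambda>j. if j = skip k i then 1 else 0))" if "i \<le> p" for i
      using that by (simp add: face affine_vertex_map_vertex)
    have "word_weights (labels p (singular_face (Suc p) k g)) ?x w
        = word_weights (labels (Suc p) g) (affine_vertex_map p (skip k) ?x) w" for w
      unfolding word_weights_labels
      by (subst sum_affine_vertex_map[OF x le]) (auto intro!: sum.cong simp: lab)
    then have "blend p (singular_face (Suc p) k g) ?x t
        = blend (Suc p) g (affine_vertex_map p (skip k) ?x) t" for t
      by (simp add: blend_def face[OF x] fun_eq_iff)
    then show ?thesis
      using True by (simp add: prism_simplex_def Let_def face[OF x] comp)
  qed (simp add: prism_simplex_def Let_def)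
qed

lemma prism_simplex_bottom:
  assumes g: "singular_simplex p Y g"
  shows "prism_simplex p g p (\<lambda>j. j) (\<lambda>j. False) = g"
proof
  fix u
  show "prism_simplex p g p (\<lambda>j. j) (\<lambda>j. False) u = g u"
  proof (cases "u \<in> standard_simplex p")
    case True
    have "blend p g u 0 = coord (g u)" by (simp add: blend_def fun_eq_iff)
    then show ?thesis
      using True coord(3)[OF singular_simplex_in_topspace[OF g True]]
      by (simp add: prism_simplex_def Let_def affine_vertex_map_ident)
  next
    case False
    then show ?thesis using g by (simp add: prism_simplex_def singular_simplex_def extensional_def)
  qed
qed

text \<open>Different points of \<open>g\<close> may have different carriers;
  \<open>common_face\<close> supplies one cell that contains the whole affine simplex.\<close>

lemma prism_simplex_top:
  assumes g: "small p g"
  shows "\<exists>s\<in>S. set (labels p g) \<subseteq> verts s \<and> prism_simplex p g p (\<lambda>j. j) (\<lambda>j. True) = aff s (labels p g)"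
proof -
  have gs: "singular_simplex p Y g" using g by (simp add: small_def)
  obtain s where s: "s \<in> S" "verts s = set (labels p g)"
    "\<And>x A. \<lbrakk>x \<in> standard_simplex p; A \<in> weights (set (labels p g))\<rbrakk> \<Longrightarrow> point (cell (g x)) A = point s A"
    using common_face[OF gs, of "set (labels p g)"] set_labels_subset[OF g] by auto
  have "prism_simplex p g p (\<lambda>j. j) (\<lambda>j. True) u = aff s (labels p g) u" for u
  proof (cases "u \<in> standard_simplex p")
    case True
    have "blend p g u 1 = word_weights (labels p g) u" by (simp add: blend_def fun_eq_iff)
    moreover have "sum u {..p} = 1" using True by (simp add: standard_simplex_def)
    moreover have "word_weights (labels p g) u \<in> weights (set (labels p g))"
      using word_weights_in[of u "labels p g"] True by simp
    ultimately show ?thesis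
      using True s(3) by (simp add: prism_simplex_def Let_def affine_vertex_map_ident aff_def)
  qed (simp add: prism_simplex_def aff_def)
  then show ?thesis using s by auto
qed

text \<open>The dual of the prism operator on a simplex \<open>g\<close> of dimension
  \<open>p - 1\<close>. The \<open>i\<close>-th summand has the vertices \<open>0, ..., i\<close> at
  time 0, followed by \<open>i, ..., p - 1\<close> at time 1. For \<open>p = 0\<close> the sum is
  empty.\<close>

definition prism_cochain :: "nat \<Rightarrow> 'b cochain \<Rightarrow> 'b cochain" where
  "prism_cochain p z g = (\<Sum>i<p. z (prism_simplex (p - 1) g p (\<lambda>j. if j \<le> i then j else j - 1) (\<lambda>j. i < j)))"

text \<open>A cocycle sums to 0 over the boundary of the prism on \<open>g\<close>: the bottom gives
  \<open>z g\<close>, the top is affine and gives 0, and the side walls are prisms on the faces of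
  \<open>g\<close>.\<close>

lemma small_cocycle_eq_coboundary:
  assumes z: "\<And>f. singular_simplex (Suc p) Y f \<Longrightarrow> (\<Sum>k\<le>Suc p. z (singular_face (Suc p) k f)) = 0"
    and aff0: "\<And>s w. \<lbrakk>s \<in> S; set w \<subseteq> verts s; length w = Suc p\<rbrakk> \<Longrightarrow> z (aff s w) = 0"
    and g: "small p g"
  shows "z g = (\<Sum>k\<le>p. prism_cochain p z (singular_face p k g))"
proof -
  let ?v = "\<lambda>i j. if j \<le> i then j else j - 1 :: nat"
  define P where "P i = prism_simplex p g (Suc p) (?v i) (\<lambda>j. i < j)" for i
  define D where "D i k = z (singular_face (Suc p) k (P i))" for i k
  define R where "R i k = z (prism_simplex (p - 1) (singular_face p k g) p (?v i) (\<lambda>j. i < j))" for i k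
  \<comment> \<open>The vertices from \<open>i\<close> onwards are at time 1, so \<open>q 0\<close>
    belongs to the top and \<open>q (Suc p)\<close> to the bottom.\<close>
  define q where "q i = z (prism_simplex p g p (\<lambda>j. j) (\<lambda>j. i \<le> j))" for i
  have face: "singular_face (Suc p) k (P i) = prism_simplex p g p (\<lambda>j. ?v i (skip k j)) (\<lambda>j. i < skip k j)"
    if "k \<le> Suc p" for i k
    unfolding P_def by (rule singular_face_prism[OF that])
  have "q 0 + q (Suc p) = (\<Sum>k\<le>p. \<Sum>i<p. R i k)"
  proof (rule prism_sum)
    fix i assume i: "i \<le> p"
    have "singular_simplex (Suc p) Y (P i)"
      unfolding P_def using i by (intro singular_simplex_prism[OF g]) auto
    then show "(\<Sum>k\<le>Suc p. D i k) = 0" unfolding D_def by (rule z)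
    show "D i i = q i" "D i (Suc i) = q (Suc i)"
      unfolding D_def q_def using i by (auto simp: face intro!: arg_cong[where f = z] prism_simplex_cong)
  next
    fix i k :: nat
    assume ik: "i < p" "k \<le> i"
    obtain m where m: "p = Suc m" using ik by (cases p) auto
    have v: "?v i j \<le> m" if "j \<le> p" for j using that ik m by auto
    have "prism_simplex (p - 1) (singular_face p k g) p (?v i) (\<lambda>j. i < j)
        = prism_simplex p g p (\<lambda>j. skip k (?v i j)) (\<lambda>j. i < j)"
      using prism_simplex_face[of k m p "?v i" g "\<lambda>j. i < j", OF _ v] ik m by simp
    then show "D (Suc i) k = R i k"
      unfolding D_def R_def using ik by (auto simp: face intro!: arg_cong[where f = z] prism_simplex_cong)
  next
    fix i k :: nat
    assume ik: "i < k" "k \<le> p"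
    obtain m where m: "p = Suc m" using ik by (cases p) auto
    have v: "?v i j \<le> m" if "j \<le> p" for j using that ik m by auto
    have "prism_simplex (p - 1) (singular_face p k g) p (?v i) (\<lambda>j. i < j)
        = prism_simplex p g p (\<lambda>j. skip k (?v i j)) (\<lambda>j. i < j)"
      using prism_simplex_face[of k m p "?v i" g "\<lambda>j. i < j", OF _ v] ik m by simp
    then show "D i (Suc k) = R i k"
      unfolding D_def R_def using ik by (auto simp: face intro!: arg_cong[where f = z] prism_simplex_cong)
  qed
  moreover have "q (Suc p) = z g"
  proof -
    have "prism_simplex p g p (\<lambda>j. j) (\<lambda>j. Suc p \<le> j) = prism_simplex p g p (\<lambda>j. j) (\<lambda>j. False)"
      by (rule prism_simplex_cong) auto
    then show ?thesis using prism_simplex_bottom[of p g] g by (simp add: q_def small_def)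
  qed
  moreover have "q 0 = 0"
    using prism_simplex_top[OF g] aff0 by (auto simp: q_def)
  ultimately show ?thesis by (simp add: R_def prism_cochain_def)
qed

end

section \<open>Cocycles that vanish on the simplices of the complex\<close>

text \<open>Chains keep their integer coefficients, so that the subdivision operators of
  \<open>HOL-Homology\<close> apply; only the evaluation is modulo 2.\<close>

definition chain_eval :: "'a cochain \<Rightarrow> 'a chain \<Rightarrow> bit" where
  "chain_eval z c = (\<Sum>f\<in>Poly_Mapping.keys c. of_int (Poly_Mapping.lookup c f) * z f)"

lemma chain_eval_superset:
  assumes "finite K" "Poly_Mapping.keys c \<subseteq> K"
  shows "chain_eval z c = (\<Sum>f\<in>K. of_int (Poly_Mapping.lookup c f) * z f)"
  unfolding chain_eval_def using assms
  by (intro sum.mono_neutral_left) (auto simp: in_keys_iff)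

lemma chain_eval_0 [simp]: "chain_eval z 0 = 0"
  by (simp add: chain_eval_def)

lemma chain_eval_of [simp]: "chain_eval z (frag_of f) = z f"
  by (simp add: chain_eval_def keys_frag_of)

lemma chain_eval_add: "chain_eval z (c + d) = chain_eval z c + chain_eval z d"
proof -
  let ?K = "Poly_Mapping.keys c \<union> Poly_Mapping.keys d"
  have "chain_eval z b = (\<Sum>f\<in>?K. of_int (Poly_Mapping.lookup b f) * z f)" if "b \<in> {c, d, c + d}" for b
    using that Poly_Mapping.keys_add[of c d] by (intro chain_eval_superset) auto
  then show ?thesis by (simp add: lookup_add distrib_right sum.distrib)
qed

lemma chain_eval_diff: "chain_eval z (c - d) = chain_eval z c + chain_eval z d"
proof -
  have "chain_eval z (c - d) + chain_eval z d = chain_eval z c"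
    by (simp flip: chain_eval_add)
  then show ?thesis by (metis add.commute bit_add_self(2))
qed

lemma chain_eval_sum: "chain_eval z (sum c A) = (\<Sum>a\<in>A. chain_eval z (c a))"
  by (induction A rule: infinite_finite_induct) (auto simp: chain_eval_add)

lemma chain_eval_sign [simp]: "chain_eval z (frag_cmul ((-1) ^ k) c) = chain_eval z c"
proof (cases "even k")
  case False
  then show ?thesis using chain_eval_diff[of z 0 c] by simp
qed simp

lemma chain_eval_cong:
  "(\<And>f. f \<in> Poly_Mapping.keys c \<Longrightarrow> z f = y f) \<Longrightarrow> chain_eval z c = chain_eval y c"
  by (simp add: chain_eval_def)

lemma chain_eval_zero: "(\<And>f. f \<in> Poly_Mapping.keys c \<Longrightarrow> z f = 0) \<Longrightarrow> chain_eval z c = 0"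
  by (simp add: chain_eval_def)

text \<open>An additive operator on chains has a transpose on cochains. So a chain with even
  coefficients, on which all cochains are 0, is sent to another one of this kind.\<close>

lemma chain_eval_linear:
  assumes T: "\<And>c d. T (c - d) = T c - T d"
  shows "chain_eval z (T c) = chain_eval (\<lambda>f. chain_eval z (T (frag_of f))) c"
  using subset_UNIV
proof (induction c rule: frag_induction)
  case zero
  show ?case using T[of 0 0] by simp
next
  case (diff a b)
  then show ?case by (simp add: T chain_eval_diff)
qed simp

lemma chain_eval_boundary:
  "chain_eval z (chain_boundary p c)
    = chain_eval (\<lambda>f. if p = 0 then 0 else \<Sum>k\<le>p. z (singular_face p k f)) c"
  by (subst chain_eval_linear[OF chain_boundary_diff])
    (simp add: chain_boundary_of chain_eval_sum if_distrib[of "chain_eval z"] cong: if_cong del: sum.atMost_Suc)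

lemma singular_cocycle_set_add:
  "\<lbrakk>a \<in> singular_cocycle_set p X; b \<in> singular_cocycle_set p X\<rbrakk>
    \<Longrightarrow> (\<lambda>f. a f + b f) \<in> singular_cocycle_set p X"
  by (simp add: singular_cocycle_set_def cochain_coboundary_add singular_cochain_add)

lemma singular_cocycle_face_sum:
  assumes "z \<in> singular_cocycle_set p X" "singular_simplex (Suc p) X f"
  shows "(\<Sum>k\<le>Suc p. z (singular_face (Suc p) k f)) = 0"
proof -
  have "cochain_coboundary p X z f = 0" using assms(1) by (simp add: singular_cocycle_set_def)
  then show ?thesis using assms(2) by (simp add: cochain_coboundary_def del: sum.atMost_Suc)
qed

context simplicial_cell_complex
begin

text \<open>Modulo 2, a cocycle is a coboundary if it vanishes on all cycles; a cycle can be replaced by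
  an iterated barycentric subdivision, whose simplices are small.\<close>

lemma coboundary_if_zero_on_affine:
  assumes z: "z \<in> singular_cocycle_set p Y"
    and aff0: "\<And>s w. \<lbrakk>s \<in> S; set w \<subseteq> verts s; length w = Suc p\<rbrakk> \<Longrightarrow> z (aff s w) = 0"
  shows "z \<in> singular_coboundary_set p Y"
proof -
  \<comment> \<open>A 0-simplex has no faces, so the index set is empty in degree 0.\<close>
  let ?I = "if p = 0 then {} else {..p}"
  let ?\<delta> = "\<lambda>u f. if p = 0 then 0 else \<Sum>k\<le>p. u (singular_face p k f)"
  note zface = singular_cocycle_face_sum[OF z]
  have "sum z A = 0"
    if A: "finite A" "A \<subseteq> singular_simplex_set p Y"
      and cycle: "\<And>u :: 'b cochain. (\<Sum>f\<in>A. \<Sum>k\<in>?I. u (singular_face p k f)) = 0" for A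
  proof -
    \<comment> \<open>An integral lift of the set \<open>A\<close>. Its boundary need not vanish,
      but all cochains evaluate to 0 on it.\<close>
    define c where "c = (\<Sum>f\<in>A. frag_of f)"
    have eval_c: "chain_eval y c = sum y A" for y
      by (simp add: c_def chain_eval_sum)
    have c: "singular_chain p Y c"
      unfolding c_def using A by (intro singular_chain_sum) (auto simp: singular_chain_of)
    have c_boundary: "chain_eval u (chain_boundary p c) = 0" for u
      using cycle[of u] by (simp add: chain_eval_boundary eval_c split: if_splits)
    have cover: "openin Y U" if "U \<in> nbhd ` topspace Y" for U
      using that openin_nbhd by blast
    have cover': "topspace Y \<subseteq> \<Union> (nbhd ` topspace Y)" using mem_nbhd by blast
    obtain n where n: "\<And>m f. \<lbrakk>n \<le> m; f \<in> Poly_Mapping.keys ((singular_subdivision p ^^ m) c)\<rbrakk>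
        \<Longrightarrow> \<exists>V\<in>nbhd ` topspace Y. f \<in> standard_simplex p \<rightarrow> V"
      by (rule sufficient_iterated_singular_subdivision_exists[OF cover cover' c]) (assumption, rule that)
    define c' where "c' = (singular_subdivision p ^^ n) c"
    obtain h :: "nat \<Rightarrow> 'b chain \<Rightarrow> 'b chain" where h: "\<And>p. h p 0 = 0" "\<And>p c d. h p (c - d) = h p c - h p d"
      "\<And>p X c. singular_chain p X c \<Longrightarrow> singular_chain (Suc p) X (h p c)"
      "\<And>p X c. singular_chain p X c \<Longrightarrow> chain_boundary (Suc p) (h p c) + h (p - Suc 0) (chain_boundary p c)
          = (singular_subdivision p ^^ n) c - c"
      by (rule chain_homotopic_iterated_singular_subdivision[of n]) (rule that)
    have c'_eq: "c' = chain_boundary (Suc p) (h p c) + h (p - Suc 0) (chain_boundary p c) + c"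
      using h(4)[OF c] by (simp add: c'_def)
    have h_boundary: "chain_eval u (h (p - Suc 0) (chain_boundary p c)) = 0" for u
      by (subst chain_eval_linear[OF h(2)]) (rule c_boundary)
    have hc: "singular_chain (Suc p) Y (h p c)" by (rule h(3)[OF c])
    have "chain_eval z (chain_boundary (Suc p) (h p c)) = 0"
      unfolding chain_eval_boundary using hc zface
      by (intro chain_eval_zero) (auto simp: singular_chain_def simp del: sum.atMost_Suc)
    then have z_c': "chain_eval z c' = chain_eval z c"
      by (simp add: c'_eq chain_eval_add h_boundary)
    \<comment> \<open>\<open>c'\<close> is again a cycle modulo 2: it differs from \<open>c\<close>
      by a boundary and by the image of \<open>chain_boundary p c\<close> under \<open>h\<close>,
      which is even.\<close>
    have c'_boundary: "chain_eval u (chain_boundary p c') = 0" for u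
    proof -
      have "chain_boundary p (chain_boundary (Suc p) (h p c)) = 0"
        using chain_boundary_boundary[OF hc] by simp
      moreover have "chain_eval u (chain_boundary p (h (p - Suc 0) (chain_boundary p c))) = 0"
        by (subst chain_eval_linear[where T = "\<lambda>d. chain_boundary p (h (p - Suc 0) d)"])
          (simp_all add: h(2) chain_boundary_diff c_boundary)
      ultimately show ?thesis
        by (simp add: c'_eq chain_boundary_add chain_eval_add c_boundary)
    qed
    have c': "singular_chain p Y c'"
      unfolding c'_def by (induction n) (auto simp: c singular_chain_singular_subdivision)
    have "small p f" if f: "f \<in> Poly_Mapping.keys c'" for f
    proof -
      obtain y where "y \<in> topspace Y" "f \<in> standard_simplex p \<rightarrow> nbhd y"
        using n[OF order_refl] f unfolding c'_def by blast
      then show ?thesis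
        using c' f by (intro small_if_in_nbhd) (auto simp: singular_chain_def)
    qed
    note small = this
    have "z f = ?\<delta> (prism_cochain p z) f" if f: "f \<in> Poly_Mapping.keys c'" for f
    proof -
      have "z f = (\<Sum>k\<le>p. prism_cochain p z (singular_face p k f))"
        using zface aff0 small[OF f] by (rule small_cocycle_eq_coboundary)
      then show ?thesis by (cases "p = 0") (simp_all add: prism_cochain_def)
    qed
    then have "chain_eval z c' = chain_eval (?\<delta> (prism_cochain p z)) c'"
      by (rule chain_eval_cong)
    also have "\<dots> = 0" using c'_boundary[of "prism_cochain p z"] by (simp add: chain_eval_boundary)
    finally show "sum z A = 0" using z_c' eval_c by simp
  qed
  then have "\<exists>w. \<forall>f\<in>singular_simplex_set p Y. z f = (\<Sum>k\<in>?I. w (singular_face p k f))"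
    by (intro linear_system_mod2_solvable) simp_all
  then obtain w where w: "\<And>f. singular_simplex p Y f \<Longrightarrow> z f = (\<Sum>k\<in>?I. w (singular_face p k f))"
    by blast
  have z0: "z f = 0" if "\<not> singular_simplex p Y f" for f
    using z that by (auto simp: singular_cocycle_set_def singular_cochain_def)
  show ?thesis
  proof (cases p)
    case 0
    then have "z = (\<lambda>f. 0)" using w z0 by (metis (mono_tags, lifting) sum.empty)
    then show ?thesis by (simp add: 0)
  next
    case (Suc m)
    \<comment> \<open>The solution of the linear system is arbitrary off the singular simplices,
      whereas cochains are normalised to be 0 there.\<close>
    define w' where "w' f = (if singular_simplex m Y f then w f else 0)" for f
    have "z f = cochain_coboundary m Y w' f" for f
    proof (cases "singular_simplex p Y f")
      case True
      then have "singular_simplex m Y (singular_face p k f)" if "k \<le> p" for k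
        using singular_simplex_singular_face[OF True _ that] Suc by simp
      then have "z f = (\<Sum>k\<le>p. w' (singular_face p k f))"
        using w[OF True] Suc by (simp add: w'_def)
      then show ?thesis using True Suc by (simp add: cochain_coboundary_def)
    next
      case False
      then show ?thesis using Suc z0 by (simp add: cochain_coboundary_def)
    qed
    then have "z = cochain_coboundary m Y w'" by blast
    moreover have "singular_cochain m Y w'" by (simp add: singular_cochain_def w'_def)
    ultimately show ?thesis by (simp add: Suc)
  qed
qed

end

section \<open>Reduction from affine to ordered simplices\<close>

locale ordered_simplicial_cell_complex = simplicial_cell_complex Y S sdim \<Phi> + enumeration enum
  for Y :: "'b topology" and S :: "'c set" and sdim \<Phi> and enum :: "'b set \<Rightarrow> 'b list"
begin

definition ordered_simplex :: "'c \<Rightarrow> (nat \<Rightarrow> real) \<Rightarrow> 'b" where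
  "ordered_simplex s = aff s (enum (verts s))"

lemma length_enum_verts: "s \<in> S \<Longrightarrow> length (enum (verts s)) = Suc (sdim s)"
  by (simp add: card_verts)

text \<open>\<open>sorting_homotopy\<close> on words becomes a singular cochain \<open>c\<close>.
  Since \<open>z\<close> vanishes on sorted words, adding the coboundary of \<open>c\<close> makes
  it vanish on all affine simplices, and \<open>coboundary_if_zero_on_affine\<close>
  applies.\<close>

lemma coboundary_if_zero_on_ordered:
  assumes z: "z \<in> singular_cocycle_set p Y"
    and ord0: "\<And>s. \<lbrakk>s \<in> S; sdim s = p\<rbrakk> \<Longrightarrow> z (ordered_simplex s) = 0"
  shows "z \<in> singular_coboundary_set p Y"
proof -
  \<comment> \<open>Distinct letters span a face that is itself a cell of dimension
    \<open>p\<close>; its ordered simplex is the one on the sorted word.\<close>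
  have sorted0: "z (aff s (enum (set w))) = 0"
    if s: "s \<in> S" and w: "set w \<subseteq> verts s" "length w = Suc p" "distinct w" for s w
  proof -
    have ne: "set w \<noteq> {}" using w(2) by auto
    obtain t where t: "t \<in> S" "verts t = set w" "\<And>A. A \<in> weights (set w) \<Longrightarrow> point t A = point s A"
      using face_exists[OF s w(1) ne] by blast
    have "sdim t = p" using card_verts[OF t(1)] t(2) distinct_card[OF w(3)] w(2) by simp
    moreover have "enum (set w) \<noteq> []" using ne set_enum[of "set w"] by force
    then have "aff t (enum (set w)) = aff s (enum (set w))"
      using t(3) by (intro aff_face[OF s t(1)]) auto
    ultimately show ?thesis using ord0[OF t(1)] t(2) by (simp add: ordered_simplex_def)
  qed
  show ?thesis
  proof (cases p)
    \<comment> \<open>A word with one letter is already sorted, so no correction is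
      required.\<close>
    case 0
    have "z (aff s w) = 0" if w: "s \<in> S" "set w \<subseteq> verts s" "length w = Suc p" for s w
    proof -
      obtain v where v: "w = [v]" using w(3) 0 by (cases w) auto
      have "length (enum {v}) = 1" "set (enum {v}) = {v}" by simp_all
      then have "enum {v} = [v]" by (cases "enum {v}") auto
      then show ?thesis using sorted0[OF w] v by simp
    qed
    then show ?thesis by (rule coboundary_if_zero_on_affine[OF z])
  next
    case (Suc m)
    \<comment> \<open>\<open>z\<close> read on words in the vertices of \<open>s\<close>; it is 0 in
      the other lengths because word cochains are not graded.\<close>
    define \<zeta> where "\<zeta> s u = (if length u = Suc p then z (aff s u) else 0)" for s u
    \<comment> \<open>The homotopy depends on a cell and a word, a cochain only on the singular
      simplex. A pair is chosen; \<open>aff_eqD\<close> and the locality of the homotopy show that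
      the choice is immaterial.\<close>
    define c where "c f = (if \<exists>s u. s \<in> S \<and> set u \<subseteq> verts s \<and> length u = Suc m \<and> f = aff s u
      then case (SOME (s, u). s \<in> S \<and> set u \<subseteq> verts s \<and> length u = Suc m \<and> f = aff s u) of
        (s, u) \<Rightarrow> sorting_homotopy (\<zeta> s) u else 0)" for f
    have c_aff: "c (aff s u) = sorting_homotopy (\<zeta> s) u"
      if u: "s \<in> S" "set u \<subseteq> verts s" "length u = Suc m" for s u
    proof -
      let ?Q = "\<lambda>(s', u'). s' \<in> S \<and> set u' \<subseteq> verts s' \<and> length u' = Suc m \<and> aff s u = aff s' u'"
      obtain s' u' where su: "(SOME x. ?Q x) = (s', u')" by (cases "SOME x. ?Q x")
      have "?Q (SOME x. ?Q x)" by (rule someI[of ?Q "(s, u)"]) (use u in simp)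
      then have Q: "s' \<in> S" "set u' \<subseteq> verts s'" "length u' = Suc m" "aff s u = aff s' u'"
        unfolding su by simp_all
      have ne: "u \<noteq> []" using u by auto
      note eq = aff_eqD[OF u(1) Q(1) ne _ u(2) Q(2) Q(4)]
      have "sorting_homotopy (\<zeta> s') u = sorting_homotopy (\<zeta> s) u"
      proof (rule sorting_homotopy_cong)
        fix x assume x: "set x \<subseteq> set u"
        show "\<zeta> s' x = \<zeta> s x"
          using eq(2)[of x] x u Q by (cases "x = []") (auto simp: \<zeta>_def)
      qed
      moreover have "u' = u" using eq(1) u Q by simp
      ultimately have "c (aff s u) = (case (SOME x. ?Q x) of (s, u) \<Rightarrow> sorting_homotopy (\<zeta> s) u)"
        "(case (SOME x. ?Q x) of (s, u) \<Rightarrow> sorting_homotopy (\<zeta> s) u) = sorting_homotopy (\<zeta> s) u"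
        unfolding c_def su using u by auto
      then show ?thesis by simp
    qed
    have c: "singular_cochain m Y c"
      unfolding singular_cochain_def
    proof (intro allI impI)
      fix f assume "c f \<noteq> 0"
      then obtain s u where "s \<in> S" "set u \<subseteq> verts s" "length u = Suc m" "f = aff s u"
        unfolding c_def by (metis (no_types, lifting))
      then show "singular_simplex m Y f" using singular_simplex_aff[of s u] by force
    qed
    define b where "b = cochain_coboundary m Y c"
    have b: "b \<in> singular_coboundary_set p Y" using c by (simp add: b_def Suc)
    have "z (aff s w) + b (aff s w) = 0" if w: "s \<in> S" "set w \<subseteq> verts s" "length w = Suc p" for s w
    proof -
      have ne: "w \<noteq> []" using w by auto
      have sx: "singular_simplex (Suc m) Y (aff s w)"
        using singular_simplex_aff[OF w(1) ne w(2)] w(3) Suc by simp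
      have "b (aff s w) = (\<Sum>k\<le>p. c (singular_face p k (aff s w)))"
        using sx by (simp add: b_def cochain_coboundary_def Suc)
      also have "\<dots> = (\<Sum>k<length w. sorting_homotopy (\<zeta> s) (delete_nth k w))"
        unfolding w(3) lessThan_Suc_atMost
      proof (rule sum.cong[OF refl])
        fix k assume "k \<in> {..p}"
        then have k: "k < length w" using w by simp
        have "set (delete_nth k w) \<subseteq> verts s" using set_delete_nth w(2) by fast
        then show "c (singular_face p k (aff s w)) = sorting_homotopy (\<zeta> s) (delete_nth k w)"
          using singular_face_aff[OF w(1) k _ w(2)] c_aff[OF w(1), of "delete_nth k w"] w(3) Suc k
          by (simp add: length_delete_nth)
      qed
      also have "\<dots> = word_coboundary (sorting_homotopy (\<zeta> s)) w" by (simp add: word_coboundary_def)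
      finally have b_w: "b (aff s w) = word_coboundary (sorting_homotopy (\<zeta> s)) w" .
      \<comment> \<open>\<open>\<zeta> s\<close> inherits the cocycle condition, which removes the
        second term of the homotopy formula.\<close>
      have "word_coboundary (\<zeta> s) u = 0" if u: "set u \<subseteq> set w" for u
      proof (cases "length u = Suc (Suc p)")
        case True
        have us: "set u \<subseteq> verts s" "u \<noteq> []" using u w True by auto
        have "word_coboundary (\<zeta> s) u = (\<Sum>k\<le>Suc p. z (singular_face (Suc p) k (aff s u)))"
          unfolding word_coboundary_def True lessThan_Suc_atMost
          using singular_face_aff[OF w(1) _ _ us(1)] True
          by (intro sum.cong) (auto simp: \<zeta>_def length_delete_nth)
        also have "\<dots> = 0"
          using singular_simplex_aff[OF w(1) us(2,1)] True by (intro singular_cocycle_face_sum[OF z]) simp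
        finally show ?thesis .
      qed (auto simp: word_coboundary_def \<zeta>_def length_delete_nth intro!: sum.neutral)
      then have "sorting_homotopy (word_coboundary (\<zeta> s)) w = sorting_homotopy (\<lambda>u. 0) w"
        by (rule sorting_homotopy_cong)
      also have "\<dots> = 0"
        using sorting_homotopy_add[of "\<lambda>u. 0" "\<lambda>u. 0" w] by (simp add: bit_add_self)
      finally have "b (aff s w) = \<zeta> s w + sorted_cochain (\<zeta> s) w"
        using sorting_homotopy[of "\<zeta> s" w] b_w by simp
      moreover have "sorted_cochain (\<zeta> s) w = 0"
        using sorted0[OF w] by (auto simp: sorted_cochain_def \<zeta>_def)
      ultimately show ?thesis using w(3) by (simp add: \<zeta>_def bit_add_self)
    qed
    then have "(\<lambda>f. z f + b f) \<in> singular_coboundary_set p Y"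
      using z coboundary_in_cocycle[OF b]
      by (intro coboundary_if_zero_on_affine singular_cocycle_set_add)
    then have "(\<lambda>f. (z f + b f) + b f) \<in> singular_coboundary_set p Y"
      using b by (rule coboundary_add)
    then show ?thesis by (simp add: add.assoc bit_add_self)
  qed
qed

text \<open>For \<open>k < k'\<close> the two faces differ at their \<open>k\<close>-th vertex, as
  the vertices of a cell are distinct points. Thus the value of a coboundary on such a simplex is a
  sum over a set of faces, without cancellation.\<close>

lemma ordered_simplex_face_inj:
  assumes s: "s \<in> S" and r: "r + Suc q \<le> sdim s"
  shows "inj_on (\<lambda>k. singular_face (Suc q) k (pull_vertices (Suc q) (\<lambda>j. r + j) (ordered_simplex s))) {..Suc q}"
proof -
  let ?w = "enum (verts s)" and ?f = "\<lambda>k. singular_face (Suc q) k (pull_vertices (Suc q) (\<lambda>j. r + j) (ordered_simplex s))"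
  have f: "?f k (\<lambda>j. if j = i then 1 else 0) = ?w ! (r + skip k i)" if "k \<le> Suc q" "i \<le> q" for k i
  proof -
    have le: "skip k j \<le> Suc q" if "j \<le> q" for j using that by auto
    have "?f k = pull_vertices q (\<lambda>j. r + skip k j) (ordered_simplex s)"
      unfolding singular_face_pull_vertices[OF that(1)] by (rule pull_vertices_compose[OF le])
    then have "?f k (\<lambda>j. if j = i then 1 else 0) = ordered_simplex s (\<lambda>j. if j = r + skip k i then 1 else 0)"
      using that by (simp add: pull_vertices_def simplex_map_def affine_vertex_map_vertex)
    also have "\<dots> = ?w ! (r + skip k i)"
      unfolding ordered_simplex_def using that r by (intro aff_vertex[OF s]) (auto simp: length_enum_verts[OF s])
    finally show ?thesis .
  qed
  have "?f k \<noteq> ?f k'" if "k < k'" "k' \<le> Suc q" for k k'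
  proof
    assume "?f k = ?f k'"
    then have "?w ! (r + Suc k) = ?w ! (r + k)" using f[of k k] f[of k' k] that by simp
    then show False
      using that r distinct_enum[OF finite_verts, of s] length_enum_verts[OF s]
      by (simp add: nth_eq_iff_index_eq)
  qed
  then show ?thesis
    by (intro inj_onI) (metis atMost_iff linorder_neqE_nat)
qed

end

text \<open>Moves the cell structure to \<open>X\<close> instead of moving the cohomology classes to
  \<open>Y\<close>.\<close>

lemma simplicial_cell_complex_homeomorphic:
  assumes "simplicial_cell_complex Y S sdim \<Phi>" and h: "homeomorphic_map Y X h"
  shows "simplicial_cell_complex X S sdim (\<lambda>s. simplex_map (sdim s) h (\<Phi> s))"
proof -
  interpret simplicial_cell_complex Y S sdim \<Phi> by fact
  have inj: "inj_on h (topspace Y)" and onto: "h ` topspace Y = topspace X"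
    using h by (auto simp: homeomorphic_eq_everything_map)
  have cont: "continuous_map Y X h" using h by (rule homeomorphic_imp_continuous_map)
  have app: "simplex_map (sdim s) h (\<Phi> s) x = h (\<Phi> s x)" if "x \<in> standard_simplex (sdim s)" for s x
    using that by (simp add: simplex_map_def)
  have open_sub: "open_standard_simplex p \<subseteq> standard_simplex p" for p
    by (auto simp: open_standard_simplex_def)
  have img: "simplex_map (sdim s) h (\<Phi> s) ` A = h ` \<Phi> s ` A" if "A \<subseteq> standard_simplex (sdim s)" for s A
    using that by (force simp: app image_image intro!: image_cong)
  have cell_sub: "\<Phi> s ` open_standard_simplex (sdim s) \<subseteq> topspace Y" if "s \<in> S" for s
    using closed_cell_subset[OF that] open_sub by blast
  show ?thesis
  proof
    show "Hausdorff_space X"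
      using Hausdorff homeomorphic_Hausdorff_space homeomorphic_map_imp_homeomorphic_space[OF h] by blast
  next
    fix s assume s: "s \<in> S"
    show "singular_simplex (sdim s) X (simplex_map (sdim s) h (\<Phi> s))"
      by (rule singular_simplex_simplex_map[OF characteristic_map[OF s] cont])
    show "inj_on (simplex_map (sdim s) h (\<Phi> s)) (standard_simplex (sdim s))"
    proof (rule inj_onI)
      fix x y
      assume x: "x \<in> standard_simplex (sdim s)" and y: "y \<in> standard_simplex (sdim s)"
        and "simplex_map (sdim s) h (\<Phi> s) x = simplex_map (sdim s) h (\<Phi> s) y"
      then have "h (\<Phi> s x) = h (\<Phi> s y)" by (simp add: app)
      then have "\<Phi> s x = \<Phi> s y"
        using closed_cell_subset[OF s] x y by (intro inj_onD[OF inj]) auto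
      then show "x = y" using inj_onD[OF characteristic_inj[OF s]] x y by blast
    qed
  next
    fix x assume "x \<in> topspace X"
    then obtain y where y: "y \<in> topspace Y" "x = h y" using onto by blast
    have "x \<in> simplex_map (sdim s) h (\<Phi> s) ` open_standard_simplex (sdim s)
        \<longleftrightarrow> y \<in> \<Phi> s ` open_standard_simplex (sdim s)" if "s \<in> S" for s
      using inj_on_image_mem_iff[OF inj y(1) cell_sub[OF that]] by (simp add: img[OF open_sub] y(2))
    then show "\<exists>!s. s \<in> S \<and> x \<in> simplex_map (sdim s) h (\<Phi> s) ` open_standard_simplex (sdim s)"
      using open_cells[OF y(1)] by blast
  next
    fix s J assume "s \<in> S" "J \<subseteq> {..sdim s}" "J \<noteq> {}"
    then obtain t v where t: "t \<in> S" "bij_betw v {..sdim t} J" "pull_vertices (sdim t) v (\<Phi> s) = \<Phi> t"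
      using simplicial_face by blast
    have le: "v j \<le> sdim s" if "j \<le> sdim t" for j
      using t(2) that \<open>J \<subseteq> {..sdim s}\<close> by (auto simp: bij_betw_def)
    have "pull_vertices (sdim t) v (simplex_map (sdim s) h (\<Phi> s)) = simplex_map (sdim t) h (\<Phi> t)"
      unfolding t(3)[symmetric]
      using affine_vertex_map_in[OF _ le] by (auto simp: pull_vertices_def simplex_map_def restrict_def fun_eq_iff)
    then show "\<exists>t\<in>S. \<exists>v. bij_betw v {..sdim t} J \<and>
        pull_vertices (sdim t) v (simplex_map (sdim s) h (\<Phi> s)) = simplex_map (sdim t) h (\<Phi> t)"
      using t by blast
  next
    fix C assume C: "C \<subseteq> topspace X"
      and closed: "\<And>s. s \<in> S \<Longrightarrow> closedin X (C \<inter> simplex_map (sdim s) h (\<Phi> s) ` standard_simplex (sdim s))"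
    define D where "D = {y \<in> topspace Y. h y \<in> C}"
    have hD: "h ` D = C" using C onto by (auto simp: D_def)
    have "closedin Y D"
    proof (rule weak_topology)
      fix s assume s: "s \<in> S"
      have "h ` (D \<inter> closed_cell s) = h ` D \<inter> h ` closed_cell s"
        using closed_cell_subset[OF s] by (intro inj_on_image_Int[OF inj]) (auto simp: D_def)
      then have "closedin X (h ` (D \<inter> closed_cell s))"
        using closed[OF s] by (simp add: hD img)
      then show "closedin Y (D \<inter> closed_cell s)"
        using homeomorphic_map_closedness[OF h, of "D \<inter> closed_cell s"] by (auto simp: D_def)
    qed (simp add: D_def)
    then show "closedin X C"
      using homeomorphic_map_closedness[OF h, of D] hD by (simp add: D_def)
  qed
qed

section \<open>Products of cocycles\<close>

lemma cocycle_group_coset: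
  assumes a: "a \<in> singular_cocycle_set p X" and b: "b \<in> singular_coboundary_set p X"
  shows "singular_coboundary_set p X #>\<^bsub>cocycle_group p X\<^esub> (\<lambda>f. a f + b f)
    = singular_coboundary_set p X #>\<^bsub>cocycle_group p X\<^esub> a"
proof -
  interpret G: comm_group "cocycle_group p X" by (rule comm_group_cocycle_group)
  have "(\<lambda>f. a f + b f) = b \<otimes>\<^bsub>cocycle_group p X\<^esub> a"
    by (simp add: cocycle_group_def add.commute)
  then have "(\<lambda>f. a f + b f) \<in> singular_coboundary_set p X #>\<^bsub>cocycle_group p X\<^esub> a"
    using b by (auto simp: r_coset_def)
  then show ?thesis
    using a G.repr_independence[OF _ _ subgroup_coboundary] by (simp add: cocycle_group_def)
qed

fun cochain_prod :: "'a topology \<Rightarrow> (nat \<Rightarrow> nat) \<Rightarrow> (nat \<Rightarrow> 'a cochain) \<Rightarrow> nat \<Rightarrow> 'a cochain" where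
  "cochain_prod X d b 0 = (\<lambda>f. if singular_simplex 0 X f then 1 else 0)"
| "cochain_prod X d b (Suc 0) = b 1"
| "cochain_prod X d b (Suc (Suc n)) =
    cochain_cup (\<Sum>i=1..Suc n. d i) (d (Suc (Suc n))) X (cochain_prod X d b (Suc n)) (b (Suc (Suc n)))"

lemma unit_cochain_cocycle:
  "(\<lambda>f. if singular_simplex 0 X f then 1 else 0) \<in> singular_cocycle_set 0 X"
proof -
  have "cochain_coboundary 0 X (\<lambda>f. if singular_simplex 0 X f then 1 else 0) f = 0" for f
    using singular_simplex_singular_face[of 1 X f]
    by (cases "singular_simplex 1 X f") (simp_all add: cochain_coboundary_def bit_add_self)
  then show ?thesis by (auto simp: singular_cocycle_set_def singular_cochain_def)
qed

lemma cochain_prod_cocycle: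
  assumes "\<And>i. i \<in> {1..n} \<Longrightarrow> b i \<in> singular_cocycle_set (d i) X"
  shows "cochain_prod X d b n \<in> singular_cocycle_set (\<Sum>i=1..n. d i) X"
  using assms
proof (induction X d b n rule: cochain_prod.induct)
  case (1 X d b)
  then show ?case by (simp add: unit_cochain_cocycle)
next
  case (3 X d b n)
  then have "cochain_prod X d b (Suc n) \<in> singular_cocycle_set (\<Sum>i=1..Suc n. d i) X"
    "b (Suc (Suc n)) \<in> singular_cocycle_set (d (Suc (Suc n))) X" by auto
  from cochain_cup_cocycle[OF this] show ?case by (simp add: add_ac)
qed simp

lemma cup_prod_coset:
  assumes "\<And>i. i \<in> {1..n} \<Longrightarrow> b i \<in> singular_cocycle_set (d i) X"
    and "\<And>i. i \<in> {1..n} \<Longrightarrow> \<alpha> i = singular_coboundary_set (d i) X #>\<^bsub>cocycle_group (d i) X\<^esub> b i"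
  shows "cup_prod X d \<alpha> n = singular_coboundary_set (\<Sum>i=1..n. d i) X
    #>\<^bsub>cocycle_group (\<Sum>i=1..n. d i) X\<^esub> cochain_prod X d b n"
  using assms
proof (induction X d b n rule: cochain_prod.induct)
  case (1 X d b)
  then show ?case by (simp add: cohomology_unit_def)
next
  case (3 X d b n)
  have IH: "cup_prod X d \<alpha> (Suc n) = singular_coboundary_set (\<Sum>i=1..Suc n. d i) X
    #>\<^bsub>cocycle_group (\<Sum>i=1..Suc n. d i) X\<^esub> cochain_prod X d b (Suc n)"
    using 3 by auto
  have \<alpha>: "\<alpha> (Suc (Suc n)) = singular_coboundary_set (d (Suc (Suc n))) X
      #>\<^bsub>cocycle_group (d (Suc (Suc n))) X\<^esub> b (Suc (Suc n))"
    and b: "b (Suc (Suc n)) \<in> singular_cocycle_set (d (Suc (Suc n))) X"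
    using 3 by auto
  have "cochain_prod X d b (Suc n) \<in> singular_cocycle_set (\<Sum>i=1..Suc n. d i) X"
    using 3 by (intro cochain_prod_cocycle) auto
  moreover have "(\<Sum>i=1..Suc (Suc n). d i) = (\<Sum>i=1..Suc n. d i) + d (Suc (Suc n))"
    by simp
  ultimately show ?case
    unfolding cup_prod.simps(3) cochain_prod.simps(3) IH \<alpha> by (simp only: cup_coset[OF _ b])
qed simp

text \<open>The iterated Alexander-Whitney formula: each factor sees a block of consecutive
  vertices, and neighbouring blocks share one vertex. All blocks but the last lie in the front face
  \<open>?g\<close>.\<close>

lemma cochain_prod_apply:
  assumes "singular_simplex (\<Sum>i=1..n. d i) X f"
  shows "cochain_prod X d b n f
    = (\<Prod>i=1..n. b i (pull_vertices (d i) (\<lambda>j. (\<Sum>l=1..<i. d l) + j) f))"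
  using assms
proof (induction X d b n arbitrary: f rule: cochain_prod.induct)
  case (2 X d b)
  then have "pull_vertices (d 1) (\<lambda>j. j) f = f" by (intro pull_vertices_id) simp
  then show ?case by simp
next
  case (3 X d b n)
  let ?D = "\<Sum>i=1..Suc n. d i" and ?e = "d (Suc (Suc n))"
  let ?g = "pull_vertices ?D (\<lambda>i. i) f"
  have f: "singular_simplex (?D + ?e) X f" using 3 by (simp add: add_ac)
  have g: "singular_simplex ?D X ?g" by (rule singular_simplex_pull_vertices[OF f]) simp
  have "pull_vertices (d i) (\<lambda>j. (\<Sum>l=1..<i. d l) + j) ?g = pull_vertices (d i) (\<lambda>j. (\<Sum>l=1..<i. d l) + j) f"
    if i: "i \<in> {1..Suc n}" for i
  proof (rule pull_vertices_compose)
    fix j assume "j \<le> d i"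
    moreover have "(\<Sum>l=1..<i. d l) + d i = (\<Sum>l=1..i. d l)"
      using i by (metis atLeastAtMost_iff sum.last_plus add.commute)
    moreover have "(\<Sum>l=1..i. d l) \<le> ?D" using i by (intro sum_mono2) auto
    ultimately show "(\<Sum>l=1..<i. d l) + j \<le> ?D" by linarith
  qed
  then have "cochain_prod X d b (Suc n) ?g
      = (\<Prod>i=1..Suc n. b i (pull_vertices (d i) (\<lambda>j. (\<Sum>l=1..<i. d l) + j) f))"
    using 3(1)[OF g] by simp
  then show ?case
    using f by (simp add: cochain_cup_def atLeastLessThanSuc_atLeastAtMost mult_ac)
qed simp

section \<open>Representatives with few nonzero values\<close>

context ordered_simplicial_cell_complex
begin

lemma singular_simplex_ordered:
  assumes s: "s \<in> S"
  shows "singular_simplex (sdim s) Y (ordered_simplex s)"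
proof -
  have "enum (verts s) \<noteq> []" using set_enum[OF finite_verts, of s] by (metis verts_nonempty set_empty)
  then show ?thesis
    using singular_simplex_aff[OF s, of "enum (verts s)"] length_enum_verts[OF s]
    by (simp add: ordered_simplex_def)
qed

text \<open>Adding the coboundary of a cochain which is chosen by \<open>exists_halving_assignment\<close> makes each
  factor vanish on half of the simplices on which the previous factors do not vanish.\<close>

lemma exists_sparse_representatives:
  assumes d: "\<And>i. i \<in> {1..n} \<Longrightarrow> 1 \<le> d i"
    and a: "\<And>i. i \<in> {1..n} \<Longrightarrow> a i \<in> singular_cocycle_set (d i) Y"
    and D: "D = (\<Sum>i=1..n. d i)" and fin: "finite {s \<in> S. sdim s = D}"
    and m: "m \<le> n"
  shows "\<exists>b. (\<forall>i\<in>{1..m}. \<exists>e\<in>singular_coboundary_set (d i) Y. b i = (\<lambda>f. a i f + e f)) \<and>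
    2 ^ m * card {s \<in> S. sdim s = D \<and> (\<forall>i\<in>{1..m}.
        b i (pull_vertices (d i) (\<lambda>j. (\<Sum>l=1..<i. d l) + j) (ordered_simplex s)) = 1)}
      \<le> card {s \<in> S. sdim s = D}"
  using m
proof (induction m)
  case (Suc m)
  define \<tau> where "\<tau> i s = pull_vertices (d i) (\<lambda>j. (\<Sum>l=1..<i. d l) + j) (ordered_simplex s)" for i s
  obtain b where b: "\<And>i. i \<in> {1..m} \<Longrightarrow> \<exists>e\<in>singular_coboundary_set (d i) Y. b i = (\<lambda>f. a i f + e f)"
    "2 ^ m * card {s \<in> S. sdim s = D \<and> (\<forall>i\<in>{1..m}. b i (\<tau> i s) = 1)} \<le> card {s \<in> S. sdim s = D}"
  proof -
    have "m \<le> n" using Suc.prems by simp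
    from Suc.IH[OF this] show ?thesis using that unfolding \<tau>_def by blast
  qed
  \<comment> \<open>The simplices on which the factors chosen so far are all 1; only these matter
    for the next choice.\<close>
  define R where "R = {s \<in> S. sdim s = D \<and> (\<forall>i\<in>{1..m}. b i (\<tau> i s) = 1)}"
  have R: "finite R" unfolding R_def by (rule finite_subset[OF _ fin]) auto
  have m: "Suc m \<in> {1..n}" using Suc.prems by simp
  obtain q where q: "d (Suc m) = Suc q" using d[OF m] by (cases "d (Suc m)") auto
  let ?r = "\<Sum>l=1..<Suc m. d l"
  have "?r + d (Suc m) = (\<Sum>l=1..Suc m. d l)" by (simp add: atLeastLessThanSuc_atLeastAtMost)
  also have "\<dots> \<le> D" unfolding D using Suc.prems by (intro sum_mono2) auto
  finally have r: "?r + Suc q \<le> D" by (simp add: q)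
  \<comment> \<open>The facets of the block that the next factor sees. Positivity of
    \<open>d (Suc m)\<close> provides them.\<close>
  define \<phi> where "\<phi> s = (\<lambda>k. singular_face (Suc q) k (\<tau> (Suc m) s)) ` {..Suc q}" for s
  have inj: "inj_on (\<lambda>k. singular_face (Suc q) k (\<tau> (Suc m) s)) {..Suc q}" if "s \<in> R" for s
    using that r unfolding \<tau>_def q by (intro ordered_simplex_face_inj) (auto simp: R_def)
  have \<tau>: "singular_simplex (Suc q) Y (\<tau> (Suc m) s)" if s: "s \<in> R" for s
  proof -
    have sS: "s \<in> S" "sdim s = D" using s by (auto simp: R_def)
    have "singular_simplex D Y (ordered_simplex s)"
      using singular_simplex_ordered[OF sS(1)] sS(2) by simp
    then show ?thesis
      unfolding \<tau>_def q using r by (intro singular_simplex_pull_vertices) auto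
  qed
  obtain c where c: "\<And>f. f \<notin> (\<Union>s\<in>R. \<phi> s) \<Longrightarrow> c f = 0"
    "2 * card {s \<in> R. a (Suc m) (\<tau> (Suc m) s) + sum c (\<phi> s) = 1} \<le> card R"
    using exists_halving_assignment[of "\<Union>s\<in>R. \<phi> s" R \<phi> "\<lambda>s. a (Suc m) (\<tau> (Suc m) s)"] R
    by (auto simp: \<phi>_def)
  have cochain: "singular_cochain q Y c"
    unfolding singular_cochain_def
  proof (intro allI impI)
    fix f assume "c f \<noteq> 0"
    then obtain s k where "s \<in> R" "k \<le> Suc q" "f = singular_face (Suc q) k (\<tau> (Suc m) s)"
      using c(1) unfolding \<phi>_def by fastforce
    then show "singular_simplex q Y f"
      using singular_simplex_singular_face[OF \<tau>, of s k] by simp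
  qed
  define e where "e = cochain_coboundary q Y c"
  have e: "e \<in> singular_coboundary_set (d (Suc m)) Y" using cochain by (simp add: e_def q)
  \<comment> \<open>Distinctness of the facets turns the sum over face indices into a sum over the
    set \<open>\<phi> s\<close>.\<close>
  have e_\<tau>: "e (\<tau> (Suc m) s) = sum c (\<phi> s)" if "s \<in> R" for s
    using \<tau>[OF that] inj[OF that]
    by (simp add: e_def cochain_coboundary_def \<phi>_def sum.reindex del: sum.atMost_Suc)
  define b' where "b' = b(Suc m := (\<lambda>f. a (Suc m) f + e f))"
  have b': "\<exists>e\<in>singular_coboundary_set (d i) Y. b' i = (\<lambda>f. a i f + e f)" if "i \<in> {1..Suc m}" for i
    using that b(1)[of i] e by (cases "i = Suc m") (auto simp: b'_def)
  have "{s \<in> S. sdim s = D \<and> (\<forall>i\<in>{1..Suc m}. b' i (\<tau> i s) = 1)}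
      = {s \<in> R. a (Suc m) (\<tau> (Suc m) s) + sum c (\<phi> s) = 1}"
  proof -
    have "(\<forall>i\<in>{1..Suc m}. b' i (\<tau> i s) = 1)
        \<longleftrightarrow> (\<forall>i\<in>{1..m}. b i (\<tau> i s) = 1) \<and> a (Suc m) (\<tau> (Suc m) s) + e (\<tau> (Suc m) s) = 1" for s
      unfolding atLeastAtMostSuc_conv[of 1 m, simplified] by (auto simp: b'_def)
    then show ?thesis using e_\<tau> unfolding R_def by auto
  qed
  then have "2 ^ Suc m * card {s \<in> S. sdim s = D \<and> (\<forall>i\<in>{1..Suc m}. b' i (\<tau> i s) = 1)}
      \<le> 2 ^ m * card R"
    using c(2) by simp
  also have "\<dots> \<le> card {s \<in> S. sdim s = D}" using b(2) by (simp add: R_def)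
  finally show ?case using b' unfolding \<tau>_def by blast
qed simp

end

text \<open>\<open>card\<close> is 0 on infinite sets, hence the premise \<open>finite\<close>; with
  infinitely many simplices of this dimension the bound is trivial.\<close>

theorem theorem1:
  fixes X :: "'a topology"
    and Y :: "'b topology"
    and S :: "'c set"
    and sdim :: "'c \<Rightarrow> nat"
    and \<Phi> :: "'c \<Rightarrow> (nat \<Rightarrow> real) \<Rightarrow> 'b"
    and n :: nat
    and d :: "nat \<Rightarrow> nat"
    and \<alpha> :: "nat \<Rightarrow> 'a cochain set"
  assumes "\<And>i. i \<in> {1..n} \<Longrightarrow> d i \<ge> 1"
    and "\<And>i. i \<in> {1..n} \<Longrightarrow> \<alpha> i \<in> carrier (cohomology_group (d i) X)"
    and "cup_prod X d \<alpha> n \<noteq> \<one>\<^bsub>cohomology_group (\<Sum>i=1..n. d i) X\<^esub>"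
    and "simplicial_cell_complex Y S sdim \<Phi>"
    and "Y homeomorphic_space X"
  shows "finite {s \<in> S. sdim s = (\<Sum>i=1..n. d i)} \<longrightarrow>
    2 ^ n \<le> card {s \<in> S. sdim s = (\<Sum>i=1..n. d i)}"
proof
  define D where "D = (\<Sum>i=1..n. d i)"
  assume "finite {s \<in> S. sdim s = (\<Sum>i=1..n. d i)}"
  then have fin: "finite {s \<in> S. sdim s = D}" by (simp add: D_def)
  obtain h where "homeomorphic_map Y X h" using assms(5) homeomorphic_space by blast
  note complex = simplicial_cell_complex_homeomorphic[OF assms(4) this]
  obtain enum :: "'a set \<Rightarrow> 'a list" where "enumeration enum" using enumeration_exists by blast
  with complex interpret ordered_simplicial_cell_complex X S sdim "\<lambda>s. simplex_map (sdim s) h (\<Phi> s)" enum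
    by (rule ordered_simplicial_cell_complex.intro)
  have "\<exists>a. a \<in> singular_cocycle_set (d i) X \<and>
      \<alpha> i = singular_coboundary_set (d i) X #>\<^bsub>cocycle_group (d i) X\<^esub> a" if "i \<in> {1..n}" for i
    using assms(2)[OF that] by (auto simp: cohomology_group_def carrier_FactGroup cocycle_group_def)
  then obtain a where a: "\<And>i. i \<in> {1..n} \<Longrightarrow> a i \<in> singular_cocycle_set (d i) X"
    "\<And>i. i \<in> {1..n} \<Longrightarrow> \<alpha> i = singular_coboundary_set (d i) X #>\<^bsub>cocycle_group (d i) X\<^esub> a i"
    by metis
  let ?\<tau> = "\<lambda>i s. pull_vertices (d i) (\<lambda>j. (\<Sum>l=1..<i. d l) + j) (ordered_simplex s)"
  obtain b where b: "\<And>i. i \<in> {1..n} \<Longrightarrow> \<exists>e\<in>singular_coboundary_set (d i) X. b i = (\<lambda>f. a i f + e f)"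
    "2 ^ n * card {s \<in> S. sdim s = D \<and> (\<forall>i\<in>{1..n}. b i (?\<tau> i s) = 1)} \<le> card {s \<in> S. sdim s = D}"
    using exists_sparse_representatives[OF assms(1) a(1) D_def fin order_refl] by blast
  have b_cocycle: "b i \<in> singular_cocycle_set (d i) X" if "i \<in> {1..n}" for i
    using b(1)[OF that] a(1)[OF that] coboundary_in_cocycle singular_cocycle_set_add by metis
  have b_coset: "\<alpha> i = singular_coboundary_set (d i) X #>\<^bsub>cocycle_group (d i) X\<^esub> b i" if "i \<in> {1..n}" for i
    using b(1)[OF that] a[OF that] cocycle_group_coset by metis
  let ?z = "cochain_prod X d b n"
  have z: "?z \<in> singular_cocycle_set D X"
    unfolding D_def using b_cocycle by (rule cochain_prod_cocycle)
  \<comment> \<open>Each \<open>b i\<close> represents the same class as \<open>a i\<close>, so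
    \<open>?z\<close> represents the given nonzero product.\<close>
  have "?z \<notin> singular_coboundary_set D X"
  proof
    assume "?z \<in> singular_coboundary_set D X"
    then have "singular_coboundary_set D X #>\<^bsub>cocycle_group D X\<^esub> ?z = singular_coboundary_set D X"
      by (intro subgroup.rcos_const[OF subgroup_coboundary] comm_group.axioms(2) comm_group_cocycle_group)
    then show False
      using assms(3) cup_prod_coset[of n b d X \<alpha>, OF b_cocycle b_coset] by (simp add: D_def cohomology_group_def)
  qed
  \<comment> \<open>So at least one simplex survives all \<open>n\<close> halvings, which forces at
    least \<open>2 ^ n\<close> at the start.\<close>
  then obtain s where s: "s \<in> S" "sdim s = D" "?z (ordered_simplex s) \<noteq> 0"
    using coboundary_if_zero_on_ordered[OF z] by blast
  have "singular_simplex D X (ordered_simplex s)"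
    using singular_simplex_ordered[OF s(1)] s(2) by simp
  then have "(\<Prod>i=1..n. b i (?\<tau> i s)) \<noteq> 0"
    using s(3) cochain_prod_apply[of d n X "ordered_simplex s" b] by (simp add: D_def)
  then have "b i (?\<tau> i s) = 1" if "i \<in> {1..n}" for i
    using that prod_zero[of "{1..n}" "\<lambda>i. b i (?\<tau> i s)"] by (cases "b i (?\<tau> i s)") auto
  moreover define T where "T = {s \<in> S. sdim s = D \<and> (\<forall>i\<in>{1..n}. b i (?\<tau> i s) = 1)}"
  ultimately have "s \<in> T" using s by blast
  moreover have "finite T" unfolding T_def by (rule finite_subset[OF _ fin]) auto
  ultimately have "0 < card T" using card_gt_0_iff by blast
  then have "2 ^ n * 1 \<le> (2::nat) ^ n * card T" by (intro mult_le_mono2) simp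
  also have "\<dots> \<le> card {s \<in> S. sdim s = D}" unfolding T_def by (rule b(2))
  finally show "2 ^ n \<le> card {s \<in> S. sdim s = (\<Sum>i=1..n. d i)}" by (simp add: D_def)
qed

end
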